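(* Let $G,H$ be in the same connected component of $O_n$. Then they form a diametral pair if and only if $H\in L_G(\mathcal{N}_{n-2\lfloor n/2\rfloor,\,2\lfloor n/2\rfloor})$; hence a diametral pair is weakly diametral too. In particular $G,H$ is a diametral pair if and only if $H=-G$ in case $n$ is even, and if and only if $H\in L_G(\mathcal{N}_{1,n-1})$ in case $n$ is odd. In this last case, for given $G$, the set of points $H$ such that $G,H$ is a diametral pair is a submanifold of $O_n$ diffeomorphic to the real projective space $\mathbb{P}^{n-1}(\mathbb{R})$.
   Context: $O_n$ is the group of real orthogonal matrices of order $n$ with the Riemannian metric $g(V,W)=\operatorname{tr}(V^TW)$ induced by the Frobenius metric, with Riemannian distance $d$ on each connected component. The diameter is $\operatorname{diam}(O_n,g)=\sup\{d(G,H) : G,H \text{ in the same connected component of } O_n\}$, which equals $\sqrt{2\lfloor n/2\rfloor}\,\pi$. Two matrices $G,H$ in the same connected component of $O_n$ form a diametral pair if $d(G,H)=\operatorname{diam}(O_n,g)=\sqrt{2\lfloor n/2\rfloor}\,\pi$; they form a weakly diametral pair if there is a geodesic curve $\gamma$ of $(O_n,g)$ such that $\gamma(0)=G$ and $\gamma(1)=\gamma(-1)=H$ (constant geodesics are allowed). $\mathcal{N}_{p,n-p}$ is the set of real symmetric orthogonal matrices of order $n$ with the eigenvalues $1$ of multiplicity $p$ and $-1$ of multiplicity $n-p$. $L_G$ is the left translation $X\mapsto GX$. *)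

theory Defs
  imports "HOL-Analysis.Analysis"
begin

section \<open>Smooth maps\<close>

(* Only meant for open U: all iterated directional derivatives up to order k exist
   and are continuous. *)
fun Ck_open :: "nat \<Rightarrow> 'a::real_normed_vector set \<Rightarrow> ('a \<Rightarrow> 'b::real_normed_vector) \<Rightarrow> bool" where
  "Ck_open 0 U f \<longleftrightarrow> continuous_on U f"
| "Ck_open (Suc k) U f \<longleftrightarrow> (\<forall>x\<in>U. f differentiable (at x)) \<and>
     (\<forall>v. Ck_open k U (\<lambda>x. frechet_derivative f (at x) v))"

(* Smoothness on an arbitrary subset of a Euclidean space: locally the restriction of a
   C-infinity map defined on an open set of the ambient space. *)
definition smooth_map :: "'a::euclidean_space set \<Rightarrow> ('a \<Rightarrow> 'b::euclidean_space) \<Rightarrow> bool" where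
  "smooth_map A f \<longleftrightarrow> (\<forall>x\<in>A. \<exists>U h. open U \<and> x \<in> U \<and> (\<forall>k. Ck_open k U h) \<and>
     (\<forall>y\<in>A \<inter> U. h y = f y))"


section \<open>Charts, embedded submanifolds, diffeomorphisms\<close>

(* A chart is a pair (domain, coordinate map). The coordinates take values in a Euclidean space
   'e; the image need not be open in 'e, only in some affine subspace of it. This avoids a
   separate type for every dimension (and covers dimension 0). *)
type_synonym ('p, 'e) chart = "'p set \<times> ('p \<Rightarrow> 'e)"

definition charts :: "'e::euclidean_space set \<Rightarrow> ('e, 'e) chart set" where
  "charts M = {(U, \<phi>). openin (top_of_set M) U \<and> inj_on \<phi> U \<and>
     smooth_map U \<phi> \<and> smooth_map (\<phi> ` U) (inv_into U \<phi>) \<and>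
     (\<exists>L. subspace L \<and> openin (top_of_set L) (\<phi> ` U))}"

(* S is a k-dimensional embedded submanifold of M: around every point of S there is a chart
   of M, with model space L, in which S is cut out by a k-dimensional subspace K of L. *)
definition embedded_submanifold :: "nat \<Rightarrow> 'e::euclidean_space set \<Rightarrow> 'e set \<Rightarrow> bool" where
  "embedded_submanifold k S M \<longleftrightarrow> S \<subseteq> M \<and>
     (\<forall>p\<in>S. \<exists>(U, \<phi>)\<in>charts M. p \<in> U \<and>
        (\<exists>L K. subspace L \<and> openin (top_of_set L) (\<phi> ` U) \<and>
           subspace K \<and> K \<subseteq> L \<and> dim K = k \<and> \<phi> ` (U \<inter> S) = \<phi> ` U \<inter> K))"

definition smooth_between ::
  "('p, 'd::euclidean_space) chart set \<Rightarrow> ('q, 'e::euclidean_space) chart set \<Rightarrow> ('p \<Rightarrow> 'q) \<Rightarrow> bool"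
where
  "smooth_between \<A> \<B> F \<longleftrightarrow> (\<forall>(U, \<phi>)\<in>\<A>. \<forall>(V, \<psi>)\<in>\<B>.
     openin (top_of_set (\<phi> ` U)) (\<phi> ` (U \<inter> F -` V)) \<and>
     smooth_map (\<phi> ` (U \<inter> F -` V)) (\<psi> \<circ> F \<circ> inv_into U \<phi>))"

definition diffeomorphic ::
  "'p set \<Rightarrow> ('p, 'd::euclidean_space) chart set \<Rightarrow> 'q set \<Rightarrow> ('q, 'e::euclidean_space) chart set \<Rightarrow> bool"
where
  "diffeomorphic M \<A> N \<B> \<longleftrightarrow> (\<exists>F. bij_betw F M N \<and>
     smooth_between \<A> \<B> F \<and> smooth_between \<B> \<A> (inv_into M F))"


section \<open>Real projective space\<close>

(* With n = CARD('n) this is P^(n-1)(R), as the set of lines through the origin of R^n. *)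
definition projective_space :: "(real^'n) set set" where
  "projective_space = {l. subspace l \<and> dim l = 1}"

(* The affine chart [x_1 : ... : x_n] \<mapsto> (x_1/x_i, ..., x_n/x_i) on {x_i \<noteq> 0}; the i-th
   coordinate, constantly 1, is kept, so the image is the affine hyperplane {y. y $ i = 1}. *)
definition affine_chart :: "'n \<Rightarrow> ((real^'n) set, real^'n) chart" where
  "affine_chart i = ({l\<in>projective_space. \<exists>x\<in>l. x $ i \<noteq> 0}, \<lambda>l. THE y. y \<in> l \<and> y $ i = 1)"

definition projective_charts :: "((real^'n) set, real^'n) chart set" where
  "projective_charts = range affine_chart"


section \<open>The orthogonal group with the Frobenius metric\<close>

definition orthogonal_group :: "(real^'n^'n) set" where
  "orthogonal_group = {A. orthogonal_matrix A}"

definition frob_metric :: "real^'n^'n \<Rightarrow> real^'n^'n \<Rightarrow> real" where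
  "frob_metric V W = trace (transpose V ** W)"

(* Continuously differentiable on each piece [s i, s (i+1)], with one-sided derivatives at the
   ends. (The library's piecewise_C1_differentiable_on allows the derivative to be unbounded
   near the break points, hence curves of infinite length.) *)
definition piecewise_C1_curve :: "(real \<Rightarrow> 'e::real_normed_vector) \<Rightarrow> bool" where
  "piecewise_C1_curve c \<longleftrightarrow> (\<exists>N (s::nat \<Rightarrow> real). s 0 = 0 \<and> s N = 1 \<and>
     (\<forall>i<N. s i < s (Suc i) \<and>
        (\<exists>c'. continuous_on {s i..s (Suc i)} c' \<and>
           (\<forall>t\<in>{s i..s (Suc i)}.
              (c has_vector_derivative c' t) (at t within {s i..s (Suc i)})))))"

(* The derivative is meaningless at the finitely many break points, a null set. *)
definition curve_length :: "(real \<Rightarrow> real^'n^'n) \<Rightarrow> real" where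
  "curve_length c = integral {0..1}
     (\<lambda>t. sqrt (frob_metric (vector_derivative c (at t)) (vector_derivative c (at t))))"

(* Only meaningful for G, H in the same connected component. *)
definition riem_dist :: "real^'n^'n \<Rightarrow> real^'n^'n \<Rightarrow> real" where
  "riem_dist G H = Inf {curve_length c | c. piecewise_C1_curve c \<and>
     c ` {0..1} \<subseteq> orthogonal_group \<and> c 0 = G \<and> c 1 = H}"

definition riem_diam :: "'n::finite itself \<Rightarrow> real" where
  "riem_diam _ = Sup {riem_dist G H | G H :: real^'n^'n. connected_component orthogonal_group G H}"

definition diametral_pair :: "real^'n^'n \<Rightarrow> real^'n^'n \<Rightarrow> bool" where
  "diametral_pair G H \<longleftrightarrow> connected_component orthogonal_group G H \<and>
     riem_dist G H = riem_diam TYPE('n)"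

definition tangent_space :: "'e::euclidean_space set \<Rightarrow> 'e \<Rightarrow> 'e set" where
  "tangent_space M p = {v. \<exists>e>0. \<exists>c. smooth_map {-e<..<e} c \<and> c ` {-e<..<e} \<subseteq> M \<and> c 0 = p \<and>
     (c has_vector_derivative v) (at 0)}"

(* The metric is induced by the ambient Euclidean metric, so the covariant derivative of the
   velocity along a curve is the tangential part of its second derivative; a geodesic is a curve
   for which this vanishes. The group is complete, so geodesics are defined on all of R. *)
definition geodesic :: "(real \<Rightarrow> real^'n^'n) \<Rightarrow> bool" where
  "geodesic c \<longleftrightarrow> smooth_map UNIV c \<and> range c \<subseteq> orthogonal_group \<and>
     (\<forall>t. \<forall>v\<in>tangent_space orthogonal_group (c t).
        frob_metric (vector_derivative (\<lambda>s. vector_derivative c (at s)) (at t)) v = 0)"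

definition weakly_diametral_pair :: "real^'n^'n \<Rightarrow> real^'n^'n \<Rightarrow> bool" where
  "weakly_diametral_pair G H \<longleftrightarrow> connected_component orthogonal_group G H \<and>
     (\<exists>c. geodesic c \<and> c 0 = G \<and> c 1 = H \<and> c (-1) = H)"

definition eigenspace :: "real^'n^'n \<Rightarrow> real \<Rightarrow> (real^'n) set" where
  "eigenspace A a = {x. A *v x = a *\<^sub>R x}"

(* Multiplicity 0 means that the number is not an eigenvalue. *)
definition sym_orthogonal :: "nat \<Rightarrow> nat \<Rightarrow> (real^'n^'n) set" where
  "sym_orthogonal p q = {A. transpose A = A \<and> orthogonal_matrix A \<and>
     dim (eigenspace A 1) = p \<and> dim (eigenspace A (-1)) = q}"

definition left_translation :: "real^'n^'n \<Rightarrow> real^'n^'n \<Rightarrow> real^'n^'n" where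
  "left_translation G X = G ** X"

end

theory Submission
  imports Defs
begin

text \<open>
  Left multiplication is isometric, so let \<open>G = 1\<close>. A special orthogonal \<open>Q\<close> is a product of
  \<open>k \<le> n div 2\<close> rotations by angles \<open>0 < a i \<le> pi\<close> in pairwise orthogonal planes; rotating at constant
  speed joins \<open>1\<close> to \<open>Q\<close> by a curve of length \<open>sqrt (2 * (\<Sum>i<k. (a i)\<^sup>2))\<close>, which reaches
  \<open>sqrt (2 * (n div 2)) * pi\<close> only if \<open>Q\<close> is \<open>-1\<close> on a subspace of dimension \<open>2 * (n div 2)\<close>.
  Conversely, if \<open>Q\<close> is \<open>-1\<close> on a subspace with orthonormal basis \<open>B\<close> of \<open>m\<close> vectors, a curve \<open>c\<close> from
  \<open>1\<close> to \<open>Q\<close> moves each \<open>b \<in> B\<close> to \<open>-b\<close> on the unit sphere, along a path of length at least \<open>pi\<close>;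
  as \<open>(\<Sum>b\<in>B. norm (c' b)) \<le> sqrt m * norm c'\<close>, the length of \<open>c\<close> is at least \<open>sqrt m * pi\<close>.

  For odd \<open>n\<close> the partners of \<open>G\<close> are \<open>G (2 x x\<^sup>T - 1)\<close> with \<open>norm x = 1\<close>. In the Cayley chart around
  such a point, given by the reflection \<open>N\<close>, they correspond to the skew matrices that anticommute
  with \<open>N\<close>.
\<close>

section \<open>Calculus of smooth maps\<close>

text \<open>\<open>riem_dist\<close> is never computed in general. Every pair gets an upper bound
  from one explicit curve, only pairs with a large (-1)-eigenspace get a lower bound, and the two
  meet exactly at the claimed diameter; this identifies both the supremum and the pairs that attain
  it. In the lower bound all vectors of \<open>B\<close> must be followed at once: a single one
  would give no more than \<open>pi\<close>. \<open>Inf\<close>, \<open>Sup\<close>,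
  \<open>integral\<close> and \<open>vector_derivative\<close> are total functions with default
  values, so non-emptiness, boundedness and integrability are established along with the estimates.
  The Cayley transform replaces the exponential map because it is rational: smoothness reduces to
  Cramer's rule, its image is a whole linear space, and the involutions near a given one become a
  linear subspace. \<open>smooth_between\<close> ranges over all charts of the set of partners. The
  map to projective space and its inverse are therefore written as rational formulas in ambient
  coordinates, which compose with any chart.\<close>

lemma Ck_open_Suc_imp: "Ck_open (Suc k) U f \<Longrightarrow> Ck_open k U f"
proof (induction k arbitrary: f)
  case 0
  then show ?case
    by (auto intro: continuous_at_imp_continuous_on differentiable_imp_continuous_within)
next
  case (Suc k)
  then show ?case by (auto simp del: Ck_open.simps(1))
qed

lemma Ck_open_imp_continuous_on: "Ck_open k U f \<Longrightarrow> continuous_on U f"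
  by (induction k) (use Ck_open_Suc_imp in auto)

lemma Ck_open_cong:
  assumes "open U" "\<And>x. x \<in> U \<Longrightarrow> f x = g x"
  shows "Ck_open k U f = Ck_open k U g"
  using assms(2)
proof (induction k arbitrary: f g)
  case 0
  then show ?case by (auto cong: continuous_on_cong)
next
  case (Suc k)
  have hd: "(f has_derivative D) (at x) \<longleftrightarrow> (g has_derivative D) (at x)" if "x \<in> U" for x D
    using has_derivative_transform_within_open[of f D x UNIV U g]
      has_derivative_transform_within_open[of g D x UNIV U f] that assms(1) Suc.prems by auto
  then have "f differentiable (at x) \<longleftrightarrow> g differentiable (at x)" if "x \<in> U" for x
    using that by (auto simp: differentiable_def)
  \<comment> \<open>Both functions have the same candidates for a derivative, so the choice inside
    \<open>frechet_derivative\<close> agrees even where neither is differentiable.\<close>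
  moreover have "frechet_derivative f (at x) = frechet_derivative g (at x)" if "x \<in> U" for x
    using hd[OF that] by (simp add: frechet_derivative_def)
  then have "Ck_open k U (\<lambda>x. frechet_derivative f (at x) v)
      = Ck_open k U (\<lambda>x. frechet_derivative g (at x) v)" for v
    by (intro Suc.IH) auto
  ultimately show ?case by auto
qed

text \<open>Trades the derivative chosen by \<open>frechet_derivative\<close> for an explicit
  formula; the closure rules below do their induction step through it.\<close>

lemma Ck_open_Suc_iff:
  assumes "open U" "\<And>x. x \<in> U \<Longrightarrow> (f has_derivative f' x) (at x)"
  shows "Ck_open (Suc k) U f \<longleftrightarrow> (\<forall>v. Ck_open k U (\<lambda>x. f' x v))"
proof -
  have "frechet_derivative f (at x) = f' x" if "x \<in> U" for x
    using frechet_derivative_at[OF assms(2)[OF that]] by simp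
  then have "Ck_open k U (\<lambda>x. frechet_derivative f (at x) v) = Ck_open k U (\<lambda>x. f' x v)" for v
    by (intro Ck_open_cong assms(1)) auto
  then show ?thesis using assms(2) by (auto simp: differentiable_def)
qed

lemma Ck_open_subset:
  assumes "Ck_open k U f" "V \<subseteq> U"
  shows "Ck_open k V f"
  using assms(1)
  by (induction k arbitrary: f) (use assms(2) continuous_on_subset in auto)

lemma Ck_open_has_derivative:
  assumes "Ck_open (Suc k) U f" "x \<in> U"
  shows "(f has_derivative frechet_derivative f (at x)) (at x)"
  using assms frechet_derivative_works by auto

lemma Ck_open_const: "Ck_open k U (\<lambda>x. c)"
  by (induction k arbitrary: c) (auto simp: frechet_derivative_const)

lemma Ck_open_bounded_linear:
  assumes "bounded_linear f"
  shows "Ck_open k U f"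
proof (cases k)
  case 0
  then show ?thesis using assms by (simp add: linear_continuous_on)
next
  case (Suc n)
  have "frechet_derivative f (at x) = f" for x
    using frechet_derivative_at[OF bounded_linear_imp_has_derivative[OF assms, of "at x"]] by simp
  then show ?thesis using Suc assms
    by (auto simp: Ck_open_const differentiable_def intro: bounded_linear_imp_has_derivative)
qed

lemma Ck_open_id: "Ck_open k U (\<lambda>x. x)"
  by (intro Ck_open_bounded_linear bounded_linear_ident)

lemma Ck_open_add:
  assumes "open U" "Ck_open k U f" "Ck_open k U g"
  shows "Ck_open k U (\<lambda>x. f x + g x)"
  using assms(2,3)
proof (induction k arbitrary: f g)
  case 0
  then show ?case by (auto intro: continuous_on_add)
next
  case (Suc k)
  show ?case
    by (subst Ck_open_Suc_iff[OF assms(1) has_derivative_add[OF Ck_open_has_derivative[OF Suc.prems(1)]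
            Ck_open_has_derivative[OF Suc.prems(2)]]])
      (use Suc in auto)
qed

lemma Ck_open_sum:
  assumes "open U" "\<And>i. i \<in> I \<Longrightarrow> Ck_open k U (f i)"
  shows "Ck_open k U (\<lambda>x. \<Sum>i\<in>I. f i x)"
  using assms(2)
  by (induction I rule: infinite_finite_induct) (auto intro: Ck_open_const Ck_open_add assms(1))

text \<open>The product rule yields a sum of two terms of the same bilinear shape, so the induction
  closes. Scalar, inner, matrix and outer products are all instances.\<close>

lemma Ck_open_bilinear:
  assumes "bounded_bilinear h" "open U" "Ck_open k U f" "Ck_open k U g"
  shows "Ck_open k U (\<lambda>x. h (f x) (g x))"
  using assms(3,4)
proof (induction k arbitrary: f g)
  case 0
  then show ?case using bounded_bilinear.continuous_on[OF assms(1)] by auto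
next
  case (Suc k)
  have "Ck_open k U f" "Ck_open k U g" using Suc.prems Ck_open_Suc_imp by blast+
  then show ?case
    by (subst Ck_open_Suc_iff[OF assms(2) bounded_bilinear.FDERIV[OF assms(1)
            Ck_open_has_derivative[OF Suc.prems(1)] Ck_open_has_derivative[OF Suc.prems(2)]]])
      (use Suc in \<open>auto intro!: Ck_open_add assms(2)\<close>)
qed

lemmas Ck_open_mult = Ck_open_bilinear[OF bounded_bilinear_mult]
lemmas Ck_open_scaleR = Ck_open_bilinear[OF bounded_bilinear_scaleR]
lemmas Ck_open_inner = Ck_open_bilinear[OF bounded_bilinear_inner]

lemma Ck_open_minus:
  assumes "open U" "Ck_open k U f"
  shows "Ck_open k U (\<lambda>x. - f x)"
  using Ck_open_scaleR[OF assms(1) Ck_open_const[of k U "-1"] assms(2)] by simp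

lemma Ck_open_diff:
  assumes "open U" "Ck_open k U f" "Ck_open k U g"
  shows "Ck_open k U (\<lambda>x. f x - g x)"
  using Ck_open_add[OF assms(1,2) Ck_open_minus[OF assms(1,3)]] by simp

lemma Ck_open_prod:
  fixes f :: "'i \<Rightarrow> 'a::real_normed_vector \<Rightarrow> real"
  assumes "open U" "\<And>i. i \<in> I \<Longrightarrow> Ck_open k U (f i)"
  shows "Ck_open k U (\<lambda>x. \<Prod>i\<in>I. f i x)"
  using assms(2)
  by (induction I rule: infinite_finite_induct) (auto intro: Ck_open_const Ck_open_mult assms(1))

lemma Ck_open_inverse:
  fixes f :: "'a::real_normed_vector \<Rightarrow> real"
  assumes "open U" "Ck_open k U f" "\<And>x. x \<in> U \<Longrightarrow> f x \<noteq> 0"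
  shows "Ck_open k U (\<lambda>x. inverse (f x))"
  using assms(2)
proof (induction k)
  case 0
  then show ?case using assms(3) by (auto intro: continuous_on_inverse)
next
  case (Suc k)
  have "Ck_open k U f" using Suc.prems Ck_open_Suc_imp by blast
  then show ?case
    by (subst Ck_open_Suc_iff[OF assms(1) Deriv.has_derivative_inverse[OF assms(3)
            Ck_open_has_derivative[OF Suc.prems]]])
      (use Suc in \<open>auto intro!: Ck_open_minus Ck_open_mult assms(1)\<close>)
qed

text \<open>The chain rule applies the derivative of \<open>f\<close> to a direction that varies
  with \<open>x\<close>, while \<open>Ck_open\<close> controls fixed directions. Expanding that
  direction in \<open>Basis\<close> leaves a finite sum of products to which the induction
  applies.\<close>

lemma Ck_open_compose:
  fixes f :: "'b::euclidean_space \<Rightarrow> 'c::real_normed_vector"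
    and g :: "'a::real_normed_vector \<Rightarrow> 'b"
  assumes "open U" "Ck_open k U g" "Ck_open k V f" "g ` U \<subseteq> V"
  shows "Ck_open k U (\<lambda>x. f (g x))"
  using assms(2,3)
proof (induction k arbitrary: f)
  case 0
  then show ?case using assms(4) by (auto intro: continuous_on_compose2)
next
  case (Suc k)
  have g: "Ck_open k U g" using Suc.prems Ck_open_Suc_imp by blast
  have fd: "(f has_derivative frechet_derivative f (at (g x))) (at (g x))" if "x \<in> U" for x
    using Ck_open_has_derivative[OF Suc.prems(2)] that assms(4) by blast
  have "((\<lambda>x. f (g x)) has_derivative
      (\<lambda>v. frechet_derivative f (at (g x)) (frechet_derivative g (at x) v))) (at x)" if "x \<in> U" for x
    using has_derivative_compose[OF Ck_open_has_derivative[OF Suc.prems(1) that] fd[OF that]] .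
  note der = this
  have expand: "frechet_derivative f (at (g x)) (frechet_derivative g (at x) v) =
     (\<Sum>b\<in>Basis. (frechet_derivative g (at x) v \<bullet> b) *\<^sub>R frechet_derivative f (at (g x)) b)"
    if "x \<in> U" for x v
  proof -
    interpret linear "frechet_derivative f (at (g x))"
      using fd[OF that] has_derivative_linear by blast
    have "frechet_derivative f (at (g x)) (frechet_derivative g (at x) v) =
      frechet_derivative f (at (g x)) (\<Sum>b\<in>Basis. (frechet_derivative g (at x) v \<bullet> b) *\<^sub>R b)"
      by (simp add: euclidean_representation)
    then show ?thesis by (simp add: sum scaleR)
  qed
  have "Ck_open k U (\<lambda>x. \<Sum>b\<in>Basis. (frechet_derivative g (at x) v \<bullet> b) *\<^sub>R
      frechet_derivative f (at (g x)) b)" for v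
    using Suc.prems
    by (intro Ck_open_sum Ck_open_scaleR Ck_open_inner Ck_open_const assms(1) Suc.IH[OF g]) auto
  then show ?case
    by (subst Ck_open_Suc_iff[OF assms(1) der])
      (auto simp: Ck_open_cong[OF assms(1) expand])
qed

lemma Ck_open_componentwise:
  fixes f :: "'a::real_normed_vector \<Rightarrow> 'b::euclidean_space"
  assumes "open U" "\<And>b. b \<in> Basis \<Longrightarrow> Ck_open k U (\<lambda>x. f x \<bullet> b)"
  shows "Ck_open k U f"
proof -
  have "Ck_open k U (\<lambda>x. \<Sum>b\<in>Basis. (f x \<bullet> b) *\<^sub>R b)"
    by (intro Ck_open_sum Ck_open_scaleR Ck_open_const assms)
  then show ?thesis by (simp only: euclidean_representation)
qed

lemma Ck_open_componentwise_matrix: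
  fixes f :: "'a::real_normed_vector \<Rightarrow> real^'n^'m"
  assumes "open U" "\<And>i j. Ck_open k U (\<lambda>x. f x $ i $ j)"
  shows "Ck_open k U f"
proof (rule Ck_open_componentwise[OF assms(1)])
  fix b :: "real^'n^'m" assume "b \<in> Basis"
  then obtain i j where "b = axis i (axis j 1)" by (auto simp: Basis_vec_def)
  then show "Ck_open k U (\<lambda>x. f x \<bullet> b)" using assms(2) by (simp add: inner_axis)
qed

lemma Ck_open_nth_matrix:
  "open U \<Longrightarrow> Ck_open k U f \<Longrightarrow> Ck_open k U (\<lambda>x. (f x :: real^'n^'m) $ i $ j)"
  using Ck_open_inner[of U k f "\<lambda>_. axis i (axis j 1)"] by (simp add: Ck_open_const inner_axis)

section \<open>Matrix products, determinants and inverses\<close>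

lemma bounded_bilinear_matrix_mult:
  "bounded_bilinear ((**) :: real^'n^'m \<Rightarrow> real^'p^'n \<Rightarrow> real^'p^'m)"
proof (rule bilinear_conv_bounded_bilinear[THEN iffD1])
  show "bilinear ((**) :: real^'n^'m \<Rightarrow> real^'p^'n \<Rightarrow> real^'p^'m)"
    by (auto simp: bilinear_def linear_iff matrix_matrix_mult_def vec_eq_iff algebra_simps
        sum.distrib sum_distrib_left)
qed

lemmas Ck_open_matrix_mult = Ck_open_bilinear[OF bounded_bilinear_matrix_mult]

lemma Ck_open_det:
  fixes f :: "'a::real_normed_vector \<Rightarrow> real^'n^'n"
  assumes "open U" "Ck_open k U f"
  shows "Ck_open k U (\<lambda>x. det (f x))"
  unfolding det_def
  by (intro Ck_open_sum Ck_open_mult Ck_open_const Ck_open_prod Ck_open_nth_matrix assms)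

lemma matrix_inv_mult:
  fixes A :: "real^'n^'n"
  assumes "det A \<noteq> 0"
  shows "A ** matrix_inv A = mat 1" "matrix_inv A ** A = mat 1"
proof -
  have "\<exists>A'. A ** A' = mat 1 \<and> A' ** A = mat 1"
    using assms unfolding invertible_det_nz[symmetric] invertible_def .
  from someI_ex[OF this] show "A ** matrix_inv A = mat 1" "matrix_inv A ** A = mat 1"
    unfolding matrix_inv_def by auto
qed

text \<open>Cramer's rule, one column at a time, exhibits each entry of the inverse as a polynomial
  in the entries divided by the determinant; hence inversion is smooth.\<close>

lemma matrix_inv_cramer:
  fixes A :: "real^'n^'n"
  assumes "det A \<noteq> 0"
  shows "matrix_inv A $ k $ l = det (\<chi> i j. if j = k then axis l 1 $ i else A $ i $ j) * inverse (det A)"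
proof -
  have "A *v column l (matrix_inv A) = axis l 1"
    using matrix_inv_mult(1)[OF assms]
    by (simp add: vec_eq_iff matrix_vector_mult_def matrix_matrix_mult_def column_def mat_def axis_def)
  then have "column l (matrix_inv A)
      = (\<chi> k. det (\<chi> i j. if j = k then axis l 1 $ i else A $ i $ j) / det A)"
    using cramer[OF assms] by blast
  then show ?thesis by (simp add: column_def vec_eq_iff divide_inverse)
qed

lemma Ck_open_matrix_inv:
  fixes f :: "'a::real_normed_vector \<Rightarrow> real^'n^'n"
  assumes "open U" "Ck_open k U f" "\<And>x. x \<in> U \<Longrightarrow> det (f x) \<noteq> 0"
  shows "Ck_open k U (\<lambda>x. matrix_inv (f x))"
proof (rule Ck_open_componentwise_matrix[OF assms(1)])
  fix p q :: 'n
  have "Ck_open k U (\<lambda>x. det (\<chi> i j. if j = p then axis q 1 $ i else f x $ i $ j) * inverse (det (f x)))"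
  proof (intro Ck_open_mult Ck_open_det Ck_open_inverse assms Ck_open_componentwise_matrix, goal_cases)
    case (1 i j)
    then show ?case
      by (cases "j = p") (simp_all add: Ck_open_const Ck_open_nth_matrix assms)
  qed auto
  then show "Ck_open k U (\<lambda>x. matrix_inv (f x) $ p $ q)"
    by (subst Ck_open_cong[OF assms(1) matrix_inv_cramer[OF assms(3)]]) auto
qed

section \<open>Smoothness on arbitrary subsets\<close>

lemma smooth_mapI:
  assumes "open U" "A \<subseteq> U" "\<And>k. Ck_open k U f"
  shows "smooth_map A f"
  unfolding smooth_map_def
proof
  fix x assume "x \<in> A"
  then have "open U \<and> x \<in> U \<and> (\<forall>k. Ck_open k U f) \<and> (\<forall>y\<in>A \<inter> U. f y = f y)"
    using assms by (simp add: subset_iff del: Ck_open.simps)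
  then show "\<exists>U h. open U \<and> x \<in> U \<and> (\<forall>k. Ck_open k U h) \<and> (\<forall>y\<in>A \<inter> U. h y = f y)"
    by (intro exI)
qed

lemma smooth_mapE:
  assumes "smooth_map A f" "x \<in> A"
  obtains U h where "open U" "x \<in> U" "\<forall>k. Ck_open k U h" "\<forall>y\<in>A \<inter> U. h y = f y"
  using bspec[OF assms(1)[unfolded smooth_map_def] assms(2)] by (elim exE conjE) (rule that)

lemma smooth_map_transform:
  assumes "smooth_map A f" "B \<subseteq> A" "\<And>x. x \<in> B \<Longrightarrow> f x = g x"
  shows "smooth_map B g"
  unfolding smooth_map_def
proof
  fix x assume "x \<in> B"
  with assms(2) have "x \<in> A" by blast
  from smooth_mapE[OF assms(1) this] obtain U h where U: "open U" "x \<in> U" "\<forall>k. Ck_open k U h"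
    "\<forall>y\<in>A \<inter> U. h y = f y" .
  then have "open U \<and> x \<in> U \<and> (\<forall>k. Ck_open k U h) \<and> (\<forall>y\<in>B \<inter> U. h y = g y)"
    using assms(2,3) by (simp add: subset_iff del: Ck_open.simps)
  then show "\<exists>U h. open U \<and> x \<in> U \<and> (\<forall>k. Ck_open k U h) \<and> (\<forall>y\<in>B \<inter> U. h y = g y)"
    by (intro exI)
qed

lemma smooth_map_imp_continuous_on:
  assumes "smooth_map A f"
  shows "continuous_on A f"
proof (unfold continuous_on_eq_continuous_within)
  show "\<forall>x\<in>A. continuous (at x within A) f"
  proof
    fix x assume "x \<in> A"
    with assms obtain U h where U: "open U" "x \<in> U" "\<forall>k. Ck_open k U h"
        "\<forall>y\<in>A \<inter> U. h y = f y"
      by (rule smooth_mapE)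
    have "continuous_on (A \<inter> U) h"
      using Ck_open_imp_continuous_on[OF U(3)[rule_format]] continuous_on_subset by blast
    then have "continuous_on (A \<inter> U) f"
      using U(4) continuous_on_cong[of "A \<inter> U" "A \<inter> U" h f] by simp
    then have "continuous (at x within A \<inter> U) f"
      using U(2) \<open>x \<in> A\<close> by (simp add: continuous_on_eq_continuous_within)
    then show "continuous (at x within A) f"
      using at_within_nhd[OF U(2,1), of "A \<inter> U" A] by (simp add: Int_ac)
  qed
qed

lemma smooth_map_compose:
  assumes f: "smooth_map A f" and g: "smooth_map B g" and "f ` A \<subseteq> B"
  shows "smooth_map A (\<lambda>x. g (f x))"
  unfolding smooth_map_def
proof
  fix x assume x: "x \<in> A"
  obtain U h where U: "open U" "x \<in> U" "\<forall>k. Ck_open k U h"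
      "\<forall>y\<in>A \<inter> U. h y = f y"
    using f x by (rule smooth_mapE)
  have "f x \<in> B" using assms(3) x by auto
  with g obtain V l where V: "open V" "f x \<in> V" "\<forall>k. Ck_open k V l"
      "\<forall>y\<in>B \<inter> V. l y = g y"
    by (rule smooth_mapE)
  \<comment> \<open>The extension \<open>h\<close> need not send \<open>U\<close> into
    \<open>V\<close>, so the neighbourhood is shrunk.\<close>
  define W where "W = U \<inter> h -` V"
  have "open W" unfolding W_def
    using continuous_open_preimage[OF Ck_open_imp_continuous_on[OF U(3)[rule_format]] U(1) V(1)] .
  moreover have "x \<in> W" unfolding W_def using U(2,4) V(2) x by (simp add: Ball_def)
  moreover have "Ck_open k W (\<lambda>x. l (h x))" for k
    by (rule Ck_open_compose[OF \<open>open W\<close> _ V(3)[rule_format]])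
      (auto simp: W_def intro: Ck_open_subset[OF U(3)[rule_format]])
  moreover have "\<forall>y\<in>A \<inter> W. l (h y) = g (f y)"
  proof
    fix y assume y: "y \<in> A \<inter> W"
    then have "h y = f y" using U(4) by (simp add: W_def)
    then show "l (h y) = g (f y)" using V(4) y assms(3) by (simp add: W_def image_subset_iff)
  qed
  ultimately have "open W \<and> x \<in> W \<and> (\<forall>k. Ck_open k W (\<lambda>x. l (h x))) \<and>
      (\<forall>y\<in>A \<inter> W. l (h y) = g (f y))"
    by (simp del: Ck_open.simps)
  then show "\<exists>U h. open U \<and> x \<in> U \<and> (\<forall>k. Ck_open k U h) \<and> (\<forall>y\<in>A \<inter> U. h y = g (f y))"
    by (intro exI)
qed

section \<open>Orthogonal matrices\<close>

lemmas matrix_mult_bilinear_simps =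
  bounded_bilinear.add_left[OF bounded_bilinear_matrix_mult]
  bounded_bilinear.add_right[OF bounded_bilinear_matrix_mult]
  bounded_bilinear.diff_left[OF bounded_bilinear_matrix_mult]
  bounded_bilinear.diff_right[OF bounded_bilinear_matrix_mult]
  bounded_bilinear.minus_left[OF bounded_bilinear_matrix_mult]
  bounded_bilinear.minus_right[OF bounded_bilinear_matrix_mult]
  bounded_bilinear.zero_left[OF bounded_bilinear_matrix_mult]
  bounded_bilinear.zero_right[OF bounded_bilinear_matrix_mult]
  bounded_bilinear.scaleR_left[OF bounded_bilinear_matrix_mult]
  bounded_bilinear.scaleR_right[OF bounded_bilinear_matrix_mult]

lemmas matrix_mult_sum_left = bounded_bilinear.sum_left[OF bounded_bilinear_matrix_mult]
lemmas matrix_mult_sum_right = bounded_bilinear.sum_right[OF bounded_bilinear_matrix_mult]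

lemma bounded_linear_transpose: "bounded_linear (transpose :: real^'n^'m \<Rightarrow> real^'m^'n)"
  by (rule linear_conv_bounded_linear[THEN iffD1])
    (auto simp: linear_iff transpose_def vec_eq_iff)

lemmas transpose_linear_simps =
  linear_add[OF bounded_linear.linear[OF bounded_linear_transpose]]
  linear_diff[OF bounded_linear.linear[OF bounded_linear_transpose]]
  linear_neg[OF bounded_linear.linear[OF bounded_linear_transpose]]
  linear_0[OF bounded_linear.linear[OF bounded_linear_transpose]]
  linear_scale[OF bounded_linear.linear[OF bounded_linear_transpose]]
  linear_sum[OF bounded_linear.linear[OF bounded_linear_transpose]]

lemma inner_matrix_vector: "(A *v x) \<bullet> y = x \<bullet> (transpose A *v y)" for A :: "real^'n^'m"
  by (metis dot_lmul_matrix inner_commute transpose_matrix_vector)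

lemma orthogonal_matrix_inner:
  fixes Q :: "real^'n^'n"
  assumes "orthogonal_matrix Q"
  shows "(Q *v x) \<bullet> (Q *v y) = x \<bullet> y"
  using assms by (simp add: inner_matrix_vector matrix_vector_mul_assoc orthogonal_matrix del: transpose_matrix_vector)

lemma orthogonal_matrix_norm:
  fixes Q :: "real^'n^'n"
  assumes "orthogonal_matrix Q"
  shows "norm (Q *v x) = norm x"
  by (simp add: norm_eq_sqrt_inner orthogonal_matrix_inner[OF assms])

lemma orthogonal_matrix_transpose_cancel:
  fixes Q :: "real^'n^'n"
  assumes "orthogonal_matrix Q"
  shows "transpose Q ** (Q ** A) = A" "Q ** (transpose Q ** A) = A"
    "(A ** Q) ** transpose Q = A" "(A ** transpose Q) ** Q = A"
  using assms unfolding orthogonal_matrix_def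
  by (simp_all only: matrix_mul_assoc matrix_mul_lid) (simp_all only: matrix_mul_rid flip: matrix_mul_assoc)

section \<open>Rank-one matrices, determinants and components\<close>

definition outer :: "real^'m \<Rightarrow> real^'n \<Rightarrow> real^'n^'m" where
  "outer u v = (\<chi> i j. u $ i * v $ j)"

lemma outer_mult_vector: "outer u v *v x = (v \<bullet> x) *\<^sub>R u"
  by (simp add: outer_def matrix_vector_mult_def vec_eq_iff inner_vec_def sum_distrib_left mult_ac)

lemma matrix_mult_outer: "A ** outer u v = outer (A *v u) v"
  by (simp add: outer_def matrix_matrix_mult_def matrix_vector_mult_def vec_eq_iff
      sum_distrib_right sum_distrib_left mult_ac)

lemma outer_mult_matrix: "outer u v ** A = outer u (transpose A *v v)"
  by (simp add: outer_def matrix_matrix_mult_def vector_matrix_mult_def vec_eq_iff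
      sum_distrib_right sum_distrib_left mult_ac)

lemma outer_mult_outer: "outer a b ** outer c d = (b \<bullet> c) *\<^sub>R outer a d"
  by (simp add: matrix_mult_outer outer_mult_vector) (simp add: outer_def vec_eq_iff)

lemma transpose_outer: "transpose (outer u v) = outer v u"
  by (simp add: outer_def transpose_def vec_eq_iff mult_ac)

lemma inner_outer: "outer a b \<bullet> outer c d = (a \<bullet> c) * (b \<bullet> d)"
  by (simp add: outer_def inner_vec_def sum_product) (simp add: mult_ac)

lemma bounded_bilinear_outer: "bounded_bilinear (outer :: real^'m \<Rightarrow> real^'n \<Rightarrow> real^'n^'m)"
  by (rule bilinear_conv_bounded_bilinear[THEN iffD1])
    (auto simp: bilinear_def linear_iff outer_def vec_eq_iff algebra_simps)

lemma det_uminus: "det (- A) = (-1) ^ CARD('n) * det A" for A :: "real^'n^'n"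
proof -
  have "- A = (\<chi> i. (-1) *s A $ i)" by (simp add: vec_eq_iff)
  then show ?thesis using det_rows_mul[of "\<lambda>_. -1" "\<lambda>i. A $ i"] by simp
qed

text \<open>Conjugation by an orthogonal matrix that sends a coordinate vector to \<open>x\<close>
  reduces the claim to a diagonal matrix with a single entry -1.\<close>

lemma det_reflection:
  fixes x :: "real^'n"
  assumes "norm x = 1"
  shows "det (mat 1 - 2 *\<^sub>R outer x x) = -1"
proof -
  fix k :: 'n
  define e :: "real^'n" where "e = axis k 1"
  obtain A where A: "orthogonal_matrix A" "A *v e = x"
    using orthogonal_matrix_exists_basis[OF assms] unfolding e_def by metis
  have "A ** (mat 1 - 2 *\<^sub>R outer e e) ** transpose A = mat 1 - 2 *\<^sub>R outer x x"
    using A by (simp add: matrix_mult_bilinear_simps matrix_mult_outer outer_mult_matrix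
        orthogonal_matrix_def del: transpose_matrix_vector)
  then have "det (mat 1 - 2 *\<^sub>R outer x x)
      = det A * det A * det (mat 1 - 2 *\<^sub>R outer e e)"
    by (subst (asm) eq_commute) (simp add: det_mul)
  moreover have "det A * det A = 1" using det_orthogonal_matrix[OF A(1)] by auto
  moreover have "det (mat 1 - 2 *\<^sub>R outer e e) = (\<Prod>i\<in>UNIV. if i = k then -1 else 1)"
    by (subst det_diagonal)
      (auto simp: e_def outer_def axis_def mat_def simp del: prod.delta prod.delta' intro: prod.cong)
  ultimately show ?thesis by simp
qed

text \<open>The determinant is continuous with values in {-1, 1}, and a finite connected set is a
  single point.\<close>

lemma det_connected_component:
  fixes G :: "real^'n^'n"
  assumes "connected_component orthogonal_group G H"
  shows "det G = det H"
proof -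
  obtain T where T: "connected T" "T \<subseteq> orthogonal_group" "G \<in> T" "H \<in> T"
    using assms unfolding connected_component_def by blast
  have "continuous_on T (det :: real^'n^'n \<Rightarrow> real)"
    unfolding det_def by (intro continuous_intros)
  then have "connected (det ` T)" using T(1) by (rule connected_continuous_image)
  moreover have "det ` T \<subseteq> {-1, 1}"
    using T(2) det_orthogonal_matrix by (auto simp: orthogonal_group_def)
  then have "finite (det ` T)" using finite_subset by blast
  ultimately obtain a where "det ` T = {a}"
    using T(3) connected_finite_iff_sing by blast
  then have "det G = a" "det H = a" using T(3,4) by blast+
  then show ?thesis by simp
qed

section \<open>The rotation normal form\<close>

definition plane_proj :: "real^'n \<Rightarrow> real^'n \<Rightarrow> real^'n^'n" where
  "plane_proj u w = outer u u + outer w w"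

text \<open>For an orthonormal pair this is the quarter turn from \<open>u\<close> to
  \<open>w\<close>, extended by zero to the orthogonal complement; on the plane it acts as the
  imaginary unit.\<close>

definition plane_turn :: "real^'n \<Rightarrow> real^'n \<Rightarrow> real^'n^'n" where
  "plane_turn u w = outer w u - outer u w"

text \<open>The difference of the rotation by \<open>a\<close> in the plane spanned by \<open>u\<close> and \<open>w\<close> and the identity.\<close>

definition rot :: "real^'n \<Rightarrow> real^'n \<Rightarrow> real \<Rightarrow> real^'n^'n" where
  "rot u w a = (cos a - 1) *\<^sub>R plane_proj u w + sin a *\<^sub>R plane_turn u w"

definition orthonormal_pair :: "real^'n \<Rightarrow> real^'n \<Rightarrow> bool" where
  "orthonormal_pair u w \<longleftrightarrow> u \<bullet> u = 1 \<and> w \<bullet> w = 1 \<and> u \<bullet> w = 0"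

lemma rot_0 [simp]: "rot u w 0 = 0"
  by (simp add: rot_def)

lemma transpose_rot: "transpose (rot u w a) = rot u w (- a)"
  by (simp add: rot_def plane_proj_def plane_turn_def transpose_linear_simps transpose_outer algebra_simps)

lemma plane_mult:
  assumes "orthonormal_pair u w"
  shows "plane_proj u w ** plane_proj u w = plane_proj u w"
    "plane_proj u w ** plane_turn u w = plane_turn u w"
    "plane_turn u w ** plane_proj u w = plane_turn u w"
    "plane_turn u w ** plane_turn u w = - plane_proj u w"
  using assms
  by (simp_all add: plane_proj_def plane_turn_def orthonormal_pair_def matrix_mult_bilinear_simps
      outer_mult_outer inner_commute)

text \<open>The expanded product of \<open>mat 1 + rot u w a\<close> and
  \<open>mat 1 + rot u w b\<close>: by the addition theorems these matrices form a one-parameter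
  group.\<close>

lemma rot_add:
  assumes "orthonormal_pair u w"
  shows "rot u w (a + b) = rot u w a + rot u w b + rot u w a ** rot u w b"
  unfolding rot_def cos_add sin_add
  by (simp add: matrix_mult_bilinear_simps plane_mult[OF assms] algebra_simps)

text \<open>This is why the identity is split off: what remains of rotations in orthogonal planes
  multiplies to zero, so a product of rotations becomes a sum.\<close>

lemma rot_mult_orthogonal:
  assumes "u \<bullet> u' = 0" "u \<bullet> w' = 0" "w \<bullet> u' = 0" "w \<bullet> w' = 0"
  shows "rot u w a ** rot u' w' b = 0"
  using assms
  by (simp add: rot_def plane_proj_def plane_turn_def matrix_mult_bilinear_simps outer_mult_outer)

lemma rot_mult_vector:
  "rot u w a *v x = ((cos a - 1) * (u \<bullet> x) - sin a * (w \<bullet> x)) *\<^sub>R u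
     + ((cos a - 1) * (w \<bullet> x) + sin a * (u \<bullet> x)) *\<^sub>R w"
  by (simp add: rot_def plane_proj_def plane_turn_def matrix_vector_mult_add_rdistrib
      matrix_vector_mult_diff_rdistrib scaleR_matrix_vector_assoc[symmetric] outer_mult_vector
      algebra_simps)

lemma orthogonal_matrix_rot:
  assumes "orthonormal_pair u w"
  shows "orthogonal_matrix (mat 1 + rot u w a)"
  using rot_add[OF assms, of "- a" a]
  by (simp add: orthogonal_matrix transpose_linear_simps transpose_rot matrix_mult_bilinear_simps
      algebra_simps)

text \<open>A rotation is the square of the rotation by half the angle, and the latter is orthogonal
  with determinant 1 or -1.\<close>

lemma det_rot:
  assumes "orthonormal_pair u w"
  shows "det (mat 1 + rot u w a) = 1"
proof -
  have "mat 1 + rot u w a = (mat 1 + rot u w (a/2)) ** (mat 1 + rot u w (a/2))"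
    using rot_add[OF assms, of "a/2" "a/2"] by (simp add: matrix_mult_bilinear_simps algebra_simps)
  then show ?thesis
    using det_orthogonal_matrix[OF orthogonal_matrix_rot[OF assms, of "a/2"]] by (auto simp: det_mul)
qed

text \<open>The orthogonal complement of the fixed space; its dimension is the induction measure for
  the normal form.\<close>

definition moved :: "real^'n^'n \<Rightarrow> (real^'n) set" where
  "moved Q = {y. \<forall>z. Q *v z = z \<longrightarrow> z \<bullet> y = 0}"

lemma subspace_moved: "subspace (moved Q)"
  by (auto simp: moved_def subspace_def inner_add_right)

lemma moved_image:
  assumes "orthogonal_matrix Q" "y \<in> moved Q"
  shows "Q *v y \<in> moved Q" "transpose Q *v y \<in> moved Q"
proof -
  show "Q *v y \<in> moved Q"
    using assms(2) orthogonal_matrix_inner[OF assms(1)] unfolding moved_def mem_Collect_eq by metis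
  show "transpose Q *v y \<in> moved Q"
    using assms(2) by (simp add: moved_def inner_matrix_vector[symmetric] del: transpose_matrix_vector)
qed

lemma diff_in_moved:
  assumes "orthogonal_matrix Q"
  shows "Q *v y - y \<in> moved Q"
proof -
  have "z \<bullet> (Q *v y) = z \<bullet> y" if "Q *v z = z" for z
    using orthogonal_matrix_inner[OF assms, of z y] that by simp
  then show ?thesis by (simp add: moved_def inner_diff_right)
qed

text \<open>The vector \<open>x\<close> maximises \<open>z \<bullet> Q z\<close> on the unit sphere of \<^term>\<open>moved Q\<close>, so it is an eigenvector
  of \<open>Q + Q\<^sup>T\<close> and spans an invariant plane with \<open>Q x\<close>. This degenerates only when the maximum is
  \<open>-1\<close>; then \<open>Q\<close> is \<open>-1\<close> on \<^term>\<open>moved Q\<close>, whose dimension is not 1 because \<open>det Q = 1\<close>.\<close>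

lemma invariant_plane_exists:
  fixes Q :: "real^'n^'n"
  assumes Q: "orthogonal_matrix Q" "det Q = 1" "Q \<noteq> mat 1"
  obtains x w a where "orthonormal_pair x w" "x \<in> moved Q" "w \<in> moved Q" "0 < a" "a \<le> pi"
    "Q *v x = cos a *\<^sub>R x + sin a *\<^sub>R w" "Q *v w = cos a *\<^sub>R w - sin a *\<^sub>R x"
proof -
  let ?V = "moved Q"
  note inner_Q = orthogonal_matrix_inner[OF Q(1)]
  obtain y where "Q *v y \<noteq> y"
    using Q(3) by (metis matrix_eq matrix_vector_mul_lid)
  define z where "z = (1 / norm (Q *v y - y)) *\<^sub>R (Q *v y - y)"
  have "z \<in> ?V" unfolding z_def
    by (intro subspace_scale subspace_moved diff_in_moved Q)
  moreover have "norm z = 1" using \<open>Q *v y \<noteq> y\<close> by (simp add: z_def)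
  ultimately have "?V \<inter> sphere 0 1 \<noteq> {}" by auto
  moreover have "compact (?V \<inter> sphere 0 1)"
    by (intro closed_Int_compact closed_subspace subspace_moved compact_sphere)
  moreover have "continuous_on (?V \<inter> sphere 0 1) (\<lambda>z. z \<bullet> (Q *v z))"
    by (intro continuous_intros)
  ultimately obtain x where x: "x \<in> ?V" "norm x = 1"
    and max: "\<And>z. z \<in> ?V \<Longrightarrow> norm z = 1 \<Longrightarrow> z \<bullet> (Q *v z) \<le> x \<bullet> (Q *v x)"
    using continuous_attains_sup[of "?V \<inter> sphere 0 1" "\<lambda>z. z \<bullet> (Q *v z)"]
    by (metis IntE IntI mem_sphere_0)
  have xx: "x \<bullet> x = 1" using x(2) by (simp add: dot_square_norm)
  define c where "c = x \<bullet> (Q *v x)"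
  have le: "z \<bullet> (Q *v z) \<le> c * (z \<bullet> z)" if "z \<in> ?V" for z
  proof (cases "z = 0")
    case False
    have "(1 / norm z) *\<^sub>R z \<in> ?V" using that subspace_moved subspace_scale by blast
    from max[OF this] False have "(z \<bullet> (Q *v z)) / (norm z)^2 \<le> c"
      by (simp add: c_def matrix_vector_mult_scaleR power2_eq_square)
    then show ?thesis using False by (simp add: divide_simps dot_square_norm)
  qed auto
  have stat: "y \<bullet> (Q *v x) + x \<bullet> (Q *v y) = 0" if y: "y \<in> ?V" "x \<bullet> y = 0" for y
  proof (rule ccontr)
    define b where "b = y \<bullet> (Q *v x) + x \<bullet> (Q *v y)"
    define d where "d = c * (y \<bullet> y) - y \<bullet> (Q *v y)"
    assume "\<not> ?thesis"
    then have "b \<noteq> 0" by (simp add: b_def)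
    have ineq: "t * b \<le> t^2 * d" for t
    proof -
      have "x + t *\<^sub>R y \<in> ?V" using x(1) y(1) subspace_moved subspace_add subspace_scale by blast
      from le[OF this] show ?thesis
        using xx y(2) by (simp add: c_def[symmetric] b_def d_def matrix_vector_right_distrib matrix_vector_mult_scaleR
            inner_add_left inner_add_right inner_commute[of y x] power2_eq_square algebra_simps)
    qed
    have "d \<ge> 0" using le[OF y(1)] by (simp add: d_def)
    \<comment> \<open>A value that violates \<open>ineq\<close>: the left side becomes
      \<open>b^2 / (d + 1)\<close>, the right side the same times \<open>d / (d + 1) < 1\<close>.
      The summand 1 covers \<open>d = 0\<close>.\<close>
    define t where "t = b / (d + 1)"
    have "t * b = b^2 / (d + 1)" by (simp add: t_def power2_eq_square)
    moreover have "t^2 * d = b^2 / (d + 1) * (d / (d + 1))" by (simp add: t_def power2_eq_square)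
    moreover have "b^2 / (d + 1) * (d / (d + 1)) < b^2 / (d + 1) * 1"
      using \<open>d \<ge> 0\<close> \<open>b \<noteq> 0\<close> by (intro mult_strict_left_mono) auto
    ultimately show False using ineq[of t] by simp
  qed
  have QQx: "Q *v (Q *v x) = (2 * c) *\<^sub>R (Q *v x) - x"
  proof -
    \<comment> \<open>This is \<open>Q\<close> applied to \<open>(Q + transpose Q - 2 c) x\<close>.
      By \<open>stat\<close> it is orthogonal to \<open>Q *v y\<close> for all \<open>y\<close> in
      the moved space; since it is itself such an image, it vanishes.\<close>
    define e where "e = Q *v (Q *v x) + x - (2 * c) *\<^sub>R (Q *v x)"
    have "e \<in> ?V" unfolding e_def
      by (intro subspace_diff subspace_add subspace_scale subspace_moved moved_image Q x)
    define f where "f = transpose Q *v e"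
    have Qf: "Q *v f = e" using Q(1)
      by (simp add: f_def matrix_vector_mul_assoc orthogonal_matrix_def del: transpose_matrix_vector)
    have orth: "e \<bullet> (Q *v y) = 0" if "y \<in> ?V" for y
    proof -
      define y' where "y' = y - (x \<bullet> y) *\<^sub>R x"
      have "y' \<in> ?V" unfolding y'_def using that x(1) subspace_moved subspace_diff subspace_scale by blast
      then have "y' \<bullet> (Q *v x) + x \<bullet> (Q *v y') = 0"
        by (rule stat) (simp add: y'_def inner_diff_right xx)
      then show ?thesis
        by (simp add: e_def y'_def inner_add_left inner_diff_left inner_diff_right inner_Q
            matrix_vector_mult_diff_distrib matrix_vector_mult_scaleR c_def[symmetric] inner_commute[of y]
            algebra_simps)
    qed
    have "f \<in> ?V" unfolding f_def by (intro moved_image Q \<open>e \<in> ?V\<close>)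
    then have "e \<bullet> e = 0" using orth[of f] Qf by simp
    then have "e = 0" by simp
    then show ?thesis by (simp add: e_def algebra_simps)
  qed
  have "\<bar>c\<bar> \<le> 1"
    using Cauchy_Schwarz_ineq2[of x "Q *v x"] x(2) orthogonal_matrix_norm[OF Q(1)] by (simp add: c_def)
  have "c \<noteq> 1"
  proof
    assume "c = 1"
    have "(Q *v x - x) \<bullet> (Q *v x - x) = 2 - 2 * c"
      by (simp add: inner_diff_left inner_diff_right inner_Q xx inner_commute[of "Q *v x"] c_def[symmetric])
    with \<open>c = 1\<close> have "Q *v x = x" by simp
    then have "x \<bullet> x = 0" using x(1) unfolding moved_def by blast
    then show False using xx by simp
  qed
  show thesis
  proof (cases "c = -1")
    case False
    define a where "a = arccos c"
    have "cos a = c" "0 < a" "a < pi"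
      using \<open>\<bar>c\<bar> \<le> 1\<close> \<open>c \<noteq> 1\<close> False by (auto simp: a_def cos_arccos_abs intro: arccos_lt_bounded[THEN conjunct1] arccos_lt_bounded[THEN conjunct2])
    have "sin a > 0" using \<open>0 < a\<close> \<open>a < pi\<close> sin_gt_zero by blast
    have ss: "sin a * sin a = 1 - c * c"
      using sin_cos_squared_add[of a] \<open>cos a = c\<close> by (simp add: power2_eq_square)
    define w where "w = (1 / sin a) *\<^sub>R (Q *v x - c *\<^sub>R x)"
    have Qx: "Q *v x = c *\<^sub>R x + sin a *\<^sub>R w"
      using \<open>sin a > 0\<close> by (simp add: w_def)
    have "w \<in> ?V" unfolding w_def
      by (intro subspace_diff subspace_scale subspace_moved moved_image Q x)
    moreover have "c * c \<noteq> 1" using ss \<open>sin a > 0\<close> by auto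
    then have "orthonormal_pair x w"
      using \<open>sin a > 0\<close> xx ss
      by (simp add: orthonormal_pair_def w_def inner_diff_left inner_diff_right inner_Q
          inner_commute[of "Q *v x"] c_def[symmetric] divide_simps)
    moreover have "Q *v w = c *\<^sub>R w - sin a *\<^sub>R x"
    proof -
      have "sin a *\<^sub>R (Q *v w) = Q *v (Q *v x) - c *\<^sub>R (Q *v x)"
        using \<open>sin a > 0\<close> by (simp add: w_def matrix_vector_mult_scaleR matrix_vector_mult_diff_distrib)
      also have "\<dots> = c *\<^sub>R (Q *v x) - x"
        unfolding QQx by (simp add: algebra_simps flip: scaleR_left_distrib)
      also have "\<dots> = c *\<^sub>R (c *\<^sub>R x + sin a *\<^sub>R w) - x"
        unfolding Qx ..
      also have "\<dots> = sin a *\<^sub>R (c *\<^sub>R w) - (1 - c * c) *\<^sub>R x"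
        by (simp add: algebra_simps)
      also have "\<dots> = sin a *\<^sub>R (c *\<^sub>R w - sin a *\<^sub>R x)"
        unfolding ss[symmetric] by (simp add: algebra_simps)
      finally show ?thesis using \<open>sin a > 0\<close> by simp
    qed
    ultimately show ?thesis
      using that[of x w a] x \<open>0 < a\<close> \<open>a < pi\<close> Qx \<open>cos a = c\<close> by simp
  next
    case True
    have neg: "Q *v z = - z" if "z \<in> ?V" for z
    proof -
      have "(Q *v z + z) \<bullet> (Q *v z + z) = 2 * (z \<bullet> z) + 2 * (z \<bullet> (Q *v z))"
        by (simp add: inner_add_left inner_add_right inner_Q inner_commute[of "Q *v z"])
      also have "\<dots> \<le> 0" using le[OF that] True by simp
      finally have "Q *v z + z = 0"
        by (metis inner_eq_zero_iff inner_ge_zero order_antisym)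
      then show ?thesis by (simp add: eq_neg_iff_add_eq_0)
    qed
    have "\<exists>w\<in>?V. x \<bullet> w = 0 \<and> w \<noteq> 0"
    proof (rule ccontr)
      assume "\<not> ?thesis"
      then have triv: "w = 0" if "w \<in> ?V" "x \<bullet> w = 0" for w using that by blast
      \<comment> \<open>Every \<open>Q *v y - y\<close> is then a multiple of \<open>x\<close>,
        which makes \<open>Q\<close> the reflection in the hyperplane orthogonal to
        \<open>x\<close>, with determinant -1.\<close>
      have "Q *v y = (mat 1 - 2 *\<^sub>R outer x x) *v y" for y
      proof -
        define d where "d = Q *v y - y"
        have "d \<in> ?V" unfolding d_def by (intro diff_in_moved Q)
        then have "d - (x \<bullet> d) *\<^sub>R x \<in> ?V" using x(1) subspace_moved subspace_diff subspace_scale by blast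
        then have "d - (x \<bullet> d) *\<^sub>R x = 0"
          by (rule triv) (simp add: inner_diff_right xx)
        then have "Q *v y = y + (x \<bullet> d) *\<^sub>R x" by (simp add: d_def algebra_simps)
        moreover have "x \<bullet> d = - 2 * (x \<bullet> y)"
          using inner_Q[of x y] neg[OF x(1)] by (simp add: d_def inner_diff_right)
        ultimately have "Q *v y = y - (2 * (x \<bullet> y)) *\<^sub>R x" by simp
        then show ?thesis
          by (simp add: matrix_vector_mult_diff_rdistrib scaleR_matrix_vector_assoc[symmetric] outer_mult_vector)
      qed
      then have "Q = mat 1 - 2 *\<^sub>R outer x x" by (simp add: matrix_eq)
      then show False using Q(2) det_reflection[OF x(2)] by simp
    qed
    then obtain w where w: "w \<in> ?V" "x \<bullet> w = 0" "w \<noteq> 0" by blast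
    define v where "v = (1 / norm w) *\<^sub>R w"
    have "v \<in> ?V" unfolding v_def by (intro subspace_scale subspace_moved w)
    moreover have "orthonormal_pair x v"
      using w xx by (simp add: orthonormal_pair_def v_def dot_square_norm power2_eq_square)
    ultimately show ?thesis
      using that[of x v pi] x neg by simp
  qed
qed

definition plane_family :: "nat \<Rightarrow> (nat \<Rightarrow> real^'n) \<Rightarrow> (nat \<Rightarrow> real^'n) \<Rightarrow> bool" where
  "plane_family k u w \<longleftrightarrow> (\<forall>i<k. \<forall>j<k. u i \<bullet> u j = of_bool (i = j) \<and>
     w i \<bullet> w j = of_bool (i = j) \<and> u i \<bullet> w j = 0)"

text \<open>Undoing one rotation leaves \<open>Q'\<close>, which fixes the plane as well as
  everything fixed by \<open>Q\<close>, so the moved space shrinks strictly. The clause on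
  \<open>moved Q\<close> strengthens the induction: it makes the planes found for \<open>Q'\<close>
  orthogonal to the one split off.\<close>

theorem rotation_normal_form:
  fixes Q :: "real^'n^'n"
  assumes "orthogonal_matrix Q" "det Q = 1"
  shows "\<exists>k u w a. plane_family k u w \<and> (\<forall>i<k. 0 < a i \<and> a i \<le> pi) \<and>
    (\<forall>i<k. u i \<in> moved Q \<and> w i \<in> moved Q) \<and> Q = mat 1 + (\<Sum>i<k. rot (u i) (w i) (a i))"
  using assms
proof (induction "dim (moved Q)" arbitrary: Q rule: less_induct)
  case less
  show ?case
  proof (cases "Q = mat 1")
    case True
    then show ?thesis by (intro exI[of _ "0::nat"]) (simp add: plane_family_def)
  next
    case False
    obtain x y b where xy: "orthonormal_pair x y" "x \<in> moved Q" "y \<in> moved Q" "0 < b" "b \<le> pi"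
      "Q *v x = cos b *\<^sub>R x + sin b *\<^sub>R y" "Q *v y = cos b *\<^sub>R y - sin b *\<^sub>R x"
      using invariant_plane_exists[OF less.prems False] by blast
    define R where "R = mat 1 + rot x y b"
    have R: "orthogonal_matrix R" "det R = 1"
      using orthogonal_matrix_rot[OF xy(1)] det_rot[OF xy(1)] by (auto simp: R_def)
    define Q' where "Q' = transpose R ** Q"
    have Q': "orthogonal_matrix Q'" "det Q' = 1"
      using R less.prems by (auto simp: Q'_def det_mul intro: orthogonal_matrix_mul)
    have RQ': "Q = R ** Q'" using R(1) by (simp add: Q'_def orthogonal_matrix_transpose_cancel)
    have Q'I: "Q' *v v = v" if "Q *v v = R *v v" for v
      using that R(1) by (metis Q'_def matrix_vector_mul_assoc matrix_vector_mul_lid orthogonal_matrix)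
    have fix_xy: "Q' *v x = x" "Q' *v y = y"
      using xy(1,6,7) by (auto intro!: Q'I simp: R_def matrix_vector_mult_add_rdistrib rot_mult_vector
          orthonormal_pair_def inner_commute[of y x] algebra_simps)
    have fixes_Q': "Q' *v v = v" if "Q *v v = v" for v
    proof (rule Q'I)
      have "v \<bullet> x = 0" "v \<bullet> y = 0" using xy(2,3) that by (auto simp: moved_def)
      then show "Q *v v = R *v v" using that
        by (simp add: R_def matrix_vector_mult_add_rdistrib rot_mult_vector inner_commute[of _ v])
    qed
    have sub: "moved Q' \<subseteq> moved Q" using fixes_Q' by (auto simp: moved_def)
    have orth: "x \<bullet> v = 0" "y \<bullet> v = 0" if "v \<in> moved Q'" for v
      using that fix_xy by (auto simp: moved_def)
    have "x \<notin> moved Q'" using orth(1)[of x] xy(1) by (auto simp: orthonormal_pair_def)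
    then have "moved Q' \<subset> moved Q" using sub xy(2) by blast
    then have "dim (moved Q') < dim (moved Q)"
      by (intro dim_psubset) (simp add: span_eq_iff[THEN iffD2] subspace_moved)
    from less.hyps[OF this Q'] obtain k u w a where IH: "plane_family k u w"
      "\<forall>i<k. 0 < a i \<and> a i \<le> pi" "\<forall>i<k. u i \<in> moved Q' \<and> w i \<in> moved Q'"
      "Q' = mat 1 + (\<Sum>i<k. rot (u i) (w i) (a i))" by blast
    have "rot x y b ** rot (u i) (w i) (a i) = 0" if "i < k" for i
      using IH(3) that orth by (intro rot_mult_orthogonal) auto
    then have "Q = mat 1 + (\<Sum>i<k. rot (u i) (w i) (a i)) + rot x y b"
      unfolding RQ' R_def IH(4) by (simp add: matrix_mult_bilinear_simps matrix_mult_sum_right)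
    moreover have "(\<Sum>i<k. rot ((u(k := x)) i) ((w(k := y)) i) ((a(k := b)) i))
        = (\<Sum>i<k. rot (u i) (w i) (a i))"
      by (intro sum.cong) auto
    ultimately have "Q = mat 1 + (\<Sum>i<Suc k. rot ((u(k := x)) i) ((w(k := y)) i) ((a(k := b)) i))"
      by (simp add: add.assoc)
    moreover have "plane_family (Suc k) (u(k := x)) (w(k := y))"
      using IH(1,3) xy(1) orth orth[unfolded inner_commute[of x] inner_commute[of y]]
      by (auto simp: plane_family_def orthonormal_pair_def less_Suc_eq)
    moreover have "\<forall>i<Suc k. 0 < (a(k := b)) i \<and> (a(k := b)) i \<le> pi"
      using IH(2) xy(4,5) by (auto simp: less_Suc_eq)
    moreover have "\<forall>i<Suc k. (u(k := x)) i \<in> moved Q \<and> (w(k := y)) i \<in> moved Q"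
      using IH(3) sub xy(2,3) by (auto simp: less_Suc_eq)
    ultimately show ?thesis by blast
  qed
qed

section \<open>Rotation curves\<close>

text \<open>For a \<open>plane_family\<close> the summands annihilate one another, so this sum is
  the product of the \<open>k\<close> rotations.\<close>

definition rotations :: "nat \<Rightarrow> (nat \<Rightarrow> real^'n) \<Rightarrow> (nat \<Rightarrow> real^'n) \<Rightarrow> (nat \<Rightarrow> real) \<Rightarrow> real^'n^'n" where
  "rotations k u w a = mat 1 + (\<Sum>i<k. rot (u i) (w i) (a i))"

lemma plane_familyD:
  assumes "plane_family k u w" "i < k"
  shows "orthonormal_pair (u i) (w i)"
    and "j < k \<Longrightarrow> i \<noteq> j \<Longrightarrow> u i \<bullet> u j = 0 \<and> u i \<bullet> w j = 0 \<and> w i \<bullet> u j = 0 \<and> w i \<bullet> w j = 0"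
  using assms by (auto simp: plane_family_def orthonormal_pair_def inner_commute[of "w i" "u j"])

lemma rot_mult_rot_family:
  assumes "plane_family k u w" "i < k" "j < k" "i \<noteq> j"
  shows "rot (u i) (w i) a ** rot (u j) (w j) b = 0"
  using plane_familyD(2)[OF assms] by (intro rot_mult_orthogonal) auto

text \<open>When \<open>transpose Q ** Q\<close> is expanded, products from different planes vanish
  and each plane contributes a rotation by \<open>- a i + a i\<close>.\<close>

lemma orthogonal_matrix_rotations:
  assumes "plane_family k u w"
  shows "orthogonal_matrix (rotations k u w a)"
proof -
  let ?r = "\<lambda>i. rot (u i) (w i) (a i)" and ?s = "\<lambda>i. rot (u i) (w i) (- a i)"
  have "(\<Sum>i<k. \<Sum>j<k. ?s i ** ?r j) = (\<Sum>i<k. \<Sum>j<k. if j = i then ?s i ** ?r i else 0)"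
    by (intro sum.cong refl) (auto simp: rot_mult_rot_family[OF assms])
  then have "(\<Sum>i<k. ?s i) ** (\<Sum>i<k. ?r i) = (\<Sum>i<k. ?s i ** ?r i)"
    by (subst matrix_mult_sum_left, subst matrix_mult_sum_right) simp
  then have "(\<Sum>i<k. ?s i) + (\<Sum>i<k. ?r i) + (\<Sum>i<k. ?s i) ** (\<Sum>i<k. ?r i)
      = (\<Sum>i<k. ?s i + ?r i + ?s i ** ?r i)"
    by (simp add: sum.distrib)
  also have "\<dots> = 0"
  proof (intro sum.neutral ballI)
    fix i assume "i \<in> {..<k}"
    then show "?s i + ?r i + ?s i ** ?r i = 0"
      using rot_add[OF plane_familyD(1)[OF assms], of i "- a i" "a i"] by simp
  qed
  finally show ?thesis
    by (simp add: orthogonal_matrix rotations_def transpose_linear_simps transpose_rot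
        matrix_mult_bilinear_simps algebra_simps)
qed

definition rot_velocity :: "real^'n \<Rightarrow> real^'n \<Rightarrow> real \<Rightarrow> real^'n^'n" where
  "rot_velocity u w a = cos a *\<^sub>R plane_turn u w - sin a *\<^sub>R plane_proj u w"

lemma rotations_has_vector_derivative:
  "((\<lambda>t. rotations k u w (\<lambda>i. t * a i)) has_vector_derivative
     (\<Sum>i<k. a i *\<^sub>R rot_velocity (u i) (w i) (t * a i))) (at t within S)"
  unfolding rotations_def rot_def rot_velocity_def
  by (auto intro!: derivative_eq_intros simp: has_vector_derivative_def fun_eq_iff scaleR_sum_right algebra_simps)

text \<open>Turning a plane moves both of its basis vectors at unit speed, whence the 2 under the
  root in the diameter.\<close>

lemma inner_rot_velocity_same:
  assumes "orthonormal_pair u w"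
  shows "rot_velocity u w a \<bullet> rot_velocity u w a = 2"
proof -
  have "rot_velocity u w a \<bullet> rot_velocity u w a = cos a * cos a * 2 + sin a * sin a * 2"
    using assms
    by (simp add: rot_velocity_def plane_proj_def plane_turn_def orthonormal_pair_def
        inner_add_left inner_add_right inner_diff_left inner_diff_right inner_outer inner_commute)
  also have "\<dots> = 2 * ((sin a)\<^sup>2 + (cos a)\<^sup>2)" by (simp only: power2_eq_square algebra_simps)
  finally show ?thesis by simp
qed

lemma inner_rot_velocity_orthogonal:
  assumes "u \<bullet> u' = 0" "u \<bullet> w' = 0" "w \<bullet> u' = 0" "w \<bullet> w' = 0"
  shows "rot_velocity u w a \<bullet> rot_velocity u' w' b = 0"
  using assms
  by (simp add: rot_velocity_def plane_proj_def plane_turn_def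
      inner_add_left inner_add_right inner_diff_left inner_diff_right inner_outer)

lemma norm_rotations_velocity:
  assumes "plane_family k u w"
  shows "norm (\<Sum>i<k. a i *\<^sub>R rot_velocity (u i) (w i) (b i)) = sqrt (2 * (\<Sum>i<k. (a i)\<^sup>2))"
proof -
  let ?v = "\<lambda>i. rot_velocity (u i) (w i) (b i)"
  have "(\<Sum>i<k. a i *\<^sub>R ?v i) \<bullet> (\<Sum>i<k. a i *\<^sub>R ?v i)
      = (\<Sum>i<k. \<Sum>j<k. a i * a j * (?v i \<bullet> ?v j))"
    by (subst inner_sum_left, subst inner_sum_right) (simp add: mult_ac)
  also have "\<dots> = (\<Sum>i<k. \<Sum>j<k. if j = i then 2 * (a i)\<^sup>2 else 0)"
    using plane_familyD[OF assms]
    by (intro sum.cong refl)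
      (auto simp: inner_rot_velocity_same inner_rot_velocity_orthogonal power2_eq_square)
  finally show ?thesis by (simp add: norm_eq_sqrt_inner sum_distrib_left)
qed

section \<open>The length of curves in the orthogonal group\<close>

text \<open>Matrices are vectors of vectors, so their inner product sums over all entries and
  \<open>norm\<close> is the Frobenius norm.\<close>

lemma frob_metric_eq_inner: "frob_metric V W = V \<bullet> W"
  unfolding frob_metric_def trace_def matrix_matrix_mult_def transpose_def inner_vec_def
    vec_lambda_beta inner_real_def
  by (rule sum.swap)

lemma curve_length_eq: "curve_length c = integral {0..1} (\<lambda>t. norm (vector_derivative c (at t)))"
  by (simp add: curve_length_def frob_metric_eq_inner norm_eq_sqrt_inner)

lemma curve_length_nonneg: "0 \<le> curve_length c"
  unfolding curve_length_eq
  \<comment> \<open>A speed that is not integrable has integral 0 by convention.\<close>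
  by (cases "(\<lambda>t. norm (vector_derivative c (at t))) integrable_on {0..1}")
    (auto intro: integral_nonneg simp: not_integrable_integral)

lemma norm_orthogonal_matrix_mult:
  fixes G :: "real^'n^'n"
  assumes "orthogonal_matrix G"
  shows "norm (G ** A) = norm (A :: real^'n^'n)"
proof -
  have "frob_metric (G ** A) (G ** A) = frob_metric A A"
    by (simp add: frob_metric_def matrix_transpose_mul)
      (simp add: orthogonal_matrix_transpose_cancel[OF assms] flip: matrix_mul_assoc)
  then show ?thesis by (simp add: frob_metric_eq_inner norm_eq_sqrt_inner)
qed

lemma has_vector_derivative_matrix_mult:
  fixes G :: "real^'n^'m"
  assumes "(c has_vector_derivative c') F"
  shows "((\<lambda>t. G ** c t) has_vector_derivative G ** c') F"
  using bounded_linear.has_vector_derivative[OF bounded_bilinear.bounded_linear_right[OF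
      bounded_bilinear_matrix_mult] assms] .

lemma rotation_curve:
  fixes G :: "real^'n^'n" and a :: "nat \<Rightarrow> real"
  assumes "orthogonal_matrix G" "plane_family k u w"
  defines "c \<equiv> \<lambda>t. G ** rotations k u w (\<lambda>i. t * a i)"
  shows "piecewise_C1_curve c" "range c \<subseteq> orthogonal_group" "c 0 = G" "c 1 = G ** rotations k u w a"
    "curve_length c = sqrt (2 * (\<Sum>i<k. (a i)\<^sup>2))"
proof -
  define c' where "c' t = G ** (\<Sum>i<k. a i *\<^sub>R rot_velocity (u i) (w i) (t * a i))" for t
  have der: "(c has_vector_derivative c' t) (at t within S)" for t S
    unfolding c_def c'_def
    by (intro has_vector_derivative_matrix_mult rotations_has_vector_derivative)
  have "continuous_on S c'" for S
    unfolding c'_def rot_velocity_def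
    by (intro bounded_bilinear.continuous_on[OF bounded_bilinear_matrix_mult] continuous_intros)
  then show "piecewise_C1_curve c"
    unfolding piecewise_C1_curve_def using der
    by (intro exI[of _ "1::nat"] exI[of _ real]) auto
  show "range c \<subseteq> orthogonal_group"
    using assms orthogonal_matrix_rotations[OF assms(2)]
    by (auto simp: orthogonal_group_def c_def intro: orthogonal_matrix_mul)
  show "c 0 = G" "c 1 = G ** rotations k u w a" by (simp_all add: c_def rotations_def)
  have "vector_derivative c (at t) = c' t" for t using der vector_derivative_at by blast
  moreover have "norm (c' t) = sqrt (2 * (\<Sum>i<k. (a i)\<^sup>2))" for t
    by (simp add: c'_def norm_orthogonal_matrix_mult[OF assms(1)] norm_rotations_velocity[OF assms(2)])
  ultimately show "curve_length c = sqrt (2 * (\<Sum>i<k. (a i)\<^sup>2))"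
    by (simp add: curve_length_eq)
qed

lemma riem_dist_rotations_le:
  fixes G :: "real^'n^'n"
  assumes "orthogonal_matrix G" "plane_family k u w"
  shows "riem_dist G (G ** rotations k u w a) \<le> sqrt (2 * (\<Sum>i<k. (a i)\<^sup>2))"
  unfolding riem_dist_def
proof (rule cInf_lower)
  show "bdd_below {curve_length c |c. piecewise_C1_curve c \<and> c ` {0..1} \<subseteq> orthogonal_group \<and>
      c 0 = G \<and> c 1 = G ** rotations k u w a}"
    by (rule bdd_belowI[of _ 0]) (use curve_length_nonneg in auto)
  have "c ` {0..1} \<subseteq> orthogonal_group" if "range c \<subseteq> orthogonal_group" for c :: "real \<Rightarrow> real^'n^'n"
    using that by blast
  then show "sqrt (2 * (\<Sum>i<k. (a i)\<^sup>2)) \<in> {curve_length c |c. piecewise_C1_curve c \<and>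
      c ` {0..1} \<subseteq> orthogonal_group \<and> c 0 = G \<and> c 1 = G ** rotations k u w a}"
    using rotation_curve[OF assms, of a]
    by (intro CollectI exI[of _ "\<lambda>t. G ** rotations k u w (\<lambda>i. t * a i)"] conjI) (simp_all only:)
qed

lemma rotations_connected:
  assumes "orthogonal_matrix G" "plane_family k u w"
  shows "connected_component orthogonal_group G (G ** rotations k u w a)"
proof -
  define c where "c = (\<lambda>t. G ** rotations k u w (\<lambda>i. t * a i))"
  have "continuous_on {0..1} c" unfolding c_def rotations_def rot_def
    by (intro bounded_bilinear.continuous_on[OF bounded_bilinear_matrix_mult] continuous_intros)
  then have "connected (c ` {0..1})" by (intro connected_continuous_image) auto
  moreover have "c ` {0..1} \<subseteq> orthogonal_group"
    using rotation_curve(2)[OF assms, of a] by (auto simp: c_def)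
  moreover have "c 0 \<in> c ` {0..1}" "c 1 \<in> c ` {0..1}" by (auto intro: imageI)
  moreover have "c 0 = G" "c 1 = G ** rotations k u w a"
    using rotation_curve(3,4)[OF assms, of a] by (auto simp: c_def)
  ultimately show ?thesis unfolding connected_component_def by metis
qed

text \<open>Assuming equal determinants instead of a common component lets this result also prove
  that the former implies the latter.\<close>

lemma connected_component_rotations:
  fixes G :: "real^'n^'n"
  assumes G: "orthogonal_matrix G" "orthogonal_matrix H" "det G = det H"
  obtains k u w a where "plane_family k u w" "\<And>i. i < k \<Longrightarrow> 0 < a i \<and> a i \<le> pi"
    "transpose G ** H = rotations k u w a" "H = G ** rotations k u w a"
proof -
  have "det G * det G = 1" using det_orthogonal_matrix[OF G(1)] by auto
  then have "det (transpose G ** H) = 1" using G(3) by (simp add: det_mul)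
  then obtain k u w a where "plane_family k u w" "\<forall>i<k. 0 < a i \<and> a i \<le> pi"
    "transpose G ** H = rotations k u w a"
    using rotation_normal_form[OF orthogonal_matrix_mul[OF orthogonal_matrix_transpose[THEN iffD2, OF G(1)] G(2)]]
    unfolding rotations_def by blast
  moreover from this have "H = G ** rotations k u w a"
    using orthogonal_matrix_transpose_cancel(2)[OF G(1), of H] by simp
  ultimately show ?thesis using that by blast
qed

section \<open>The lower bound for the length\<close>

text \<open>The factor \<open>r < 1\<close> keeps \<open>arcsin\<close> differentiable where \<open>y\<close> meets \<open>p\<close> or \<open>-p\<close>; it tends to 1 in the
  end.\<close>

lemma sphere_angle_speed:
  fixes y :: "real \<Rightarrow> 'a::real_inner"
  assumes y: "(y has_vector_derivative y') (at t within {a..b})" "\<And>s. s \<in> {a..b} \<Longrightarrow> norm (y s) = 1"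
    and "a < b" "t \<in> {a..b}" "norm p = 1" "0 < r" "r < 1"
  shows "\<exists>d. ((\<lambda>s. arcsin (r * (y s \<bullet> p))) has_vector_derivative d) (at t within {a..b}) \<and> \<bar>d\<bar> \<le> norm y'"
proof -
  have "((\<lambda>s. y s \<bullet> y s) has_vector_derivative (y t \<bullet> y' + y' \<bullet> y t)) (at t within {a..b})"
    using bounded_bilinear.has_vector_derivative[OF bounded_bilinear_inner y(1) y(1)] .
  moreover have "((\<lambda>s. y s \<bullet> y s) has_vector_derivative 0) (at t within {a..b})"
    by (rule has_vector_derivative_transform[OF assms(4) _ has_vector_derivative_const[of 1]])
      (simp add: y(2) dot_square_norm)
  ultimately have "y t \<bullet> y' + y' \<bullet> y t = 0"
    using vector_derivative_unique_within_closed_interval[of a b t] assms(3,4) by (auto simp: cbox_interval)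
  then have orth: "y' \<bullet> y t = 0" by (simp add: inner_commute)
  define x where "x = y t \<bullet> p"
  have yt: "norm (y t) = 1" using y(2) assms(4) by blast
  have "\<bar>x\<bar> \<le> 1" using Cauchy_Schwarz_ineq2[of "y t" p] yt assms(5) by (simp add: x_def)
  have "\<bar>r * x\<bar> = r * \<bar>x\<bar>" using assms(6) by (simp add: abs_mult)
  also have "\<dots> \<le> r" using assms(6) \<open>\<bar>x\<bar> \<le> 1\<close> by (intro mult_left_le) auto
  finally have "\<bar>r * x\<bar> < 1" using assms(7) by linarith
  define z where "z = y' \<bullet> p"
  define d where "d = inverse (sqrt (1 - (r * x)\<^sup>2)) * (r * z)"
  have "((\<lambda>s. r * (y s \<bullet> p)) has_field_derivative r * z) (at t within {a..b})"
    using bounded_linear.has_vector_derivative[OF bounded_linear_mult_right[of r]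
        bounded_linear.has_vector_derivative[OF bounded_linear_inner_left[of p] y(1)]]
    unfolding has_real_derivative_iff_has_vector_derivative z_def .
  moreover have "DERIV arcsin (r * (y t \<bullet> p)) :> inverse (sqrt (1 - (r * x)\<^sup>2))"
    using DERIV_arcsin[of "r * x"] \<open>\<bar>r * x\<bar> < 1\<close> by (simp add: x_def abs_less_iff)
  ultimately have "((\<lambda>s. arcsin (r * (y s \<bullet> p))) has_vector_derivative d) (at t within {a..b})"
    unfolding d_def has_real_derivative_iff_has_vector_derivative[symmetric]
    by (rule DERIV_chain2[rotated])
  moreover have "\<bar>d\<bar> \<le> norm y'"
  proof -
    have "(r * x)\<^sup>2 < 1" using \<open>\<bar>r * x\<bar> < 1\<close> abs_square_less_1 by blast
    have "p \<bullet> p = 1" "y t \<bullet> y t = 1" using yt assms(5) by (simp_all add: dot_square_norm)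
    then have "norm (p - x *\<^sub>R y t) ^ 2 = 1 - x\<^sup>2"
      unfolding power2_norm_eq_inner
      by (simp add: inner_diff_left inner_diff_right inner_commute[of p "y t"] x_def[symmetric]
          power2_eq_square)
    then have nrm: "norm (p - x *\<^sub>R y t) = sqrt (1 - x\<^sup>2)"
      by (metis norm_ge_zero real_sqrt_unique)
    \<comment> \<open>As \<open>y'\<close> is orthogonal to \<open>y t\<close>, only the part of
      \<open>p\<close> orthogonal to \<open>y t\<close> counts. Its norm
      \<open>sqrt (1 - x^2)\<close> compensates the growth of the derivative of
      \<open>arcsin\<close>.\<close>
    have "z = y' \<bullet> (p - x *\<^sub>R y t)" by (simp add: z_def inner_diff_right orth)
    then have "\<bar>z\<bar> \<le> norm y' * sqrt (1 - x\<^sup>2)"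
      using Cauchy_Schwarz_ineq2[of y' "p - x *\<^sub>R y t"] nrm by simp
    then have "\<bar>r * z\<bar> \<le> norm y' * (r * sqrt (1 - x\<^sup>2))"
      using assms(6) by (simp add: abs_mult mult.left_commute mult_left_mono)
    also have "r * sqrt (1 - x\<^sup>2) = sqrt (r\<^sup>2 * (1 - x\<^sup>2))"
      using assms(6) by (simp add: real_sqrt_mult)
    also have "r\<^sup>2 * (1 - x\<^sup>2) = r\<^sup>2 - (r * x)\<^sup>2"
      by (simp add: power_mult_distrib algebra_simps)
    also have "norm y' * sqrt (r\<^sup>2 - (r * x)\<^sup>2) \<le> norm y' * sqrt (1 - (r * x)\<^sup>2)"
      using assms(6,7) by (intro mult_left_mono) (simp_all add: power_le_one)
    finally have "\<bar>r * z\<bar> \<le> norm y' * sqrt (1 - (r * x)\<^sup>2)" .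
    then show ?thesis
      using \<open>(r * x)\<^sup>2 < 1\<close> by (simp add: d_def abs_mult divide_simps mult.commute)
  qed
  ultimately show ?thesis by blast
qed

lemma Bessel_inequality:
  fixes B :: "'a::real_inner set"
  assumes "finite B" "pairwise orthogonal B" "\<And>b. b \<in> B \<Longrightarrow> norm b = 1"
  shows "(\<Sum>b\<in>B. (y \<bullet> b)\<^sup>2) \<le> y \<bullet> y"
proof -
  let ?p = "\<Sum>b\<in>B. (y \<bullet> b) *\<^sub>R b"
  have pb: "?p \<bullet> b = y \<bullet> b" if "b \<in> B" for b
  proof -
    have "?p \<bullet> b = (\<Sum>c\<in>B. if c = b then y \<bullet> b else 0)"
      unfolding inner_sum_left using assms(2,3) that
      by (intro sum.cong refl) (auto simp: pairwise_def orthogonal_def dot_square_norm)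
    then show ?thesis using assms(1) that by simp
  qed
  have "?p \<bullet> ?p = (\<Sum>b\<in>B. (y \<bullet> b)\<^sup>2)" "y \<bullet> ?p = (\<Sum>b\<in>B. (y \<bullet> b)\<^sup>2)"
    using pb by (simp_all add: inner_sum_right power2_eq_square cong: sum.cong)
  then have "(y - ?p) \<bullet> (y - ?p) = y \<bullet> y - (\<Sum>b\<in>B. (y \<bullet> b)\<^sup>2)"
    by (simp add: inner_diff_left inner_diff_right inner_commute[of ?p y])
  then show ?thesis by (metis diff_ge_0_iff_ge inner_ge_zero)
qed

text \<open>By Cauchy-Schwarz it suffices to bound the sum of the squares, and Bessel's inequality
  does so for each row of \<open>A\<close>.\<close>

lemma sum_norm_matrix_vector_le:
  fixes A :: "real^'n^'m"
  assumes "finite B" "pairwise orthogonal B" "\<And>b. b \<in> B \<Longrightarrow> norm b = 1"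
  shows "(\<Sum>b\<in>B. norm (A *v b)) \<le> sqrt (card B) * norm A"
proof -
  have "(\<Sum>b\<in>B. (norm (A *v b))\<^sup>2) = (\<Sum>b\<in>B. \<Sum>i\<in>UNIV. (A $ i \<bullet> b)\<^sup>2)"
    unfolding power2_norm_eq_inner by (simp add: inner_vec_def[of "A *v _"] matrix_vector_mul_component power2_eq_square)
  also have "\<dots> = (\<Sum>i\<in>UNIV. \<Sum>b\<in>B. (A $ i \<bullet> b)\<^sup>2)" by (rule sum.swap)
  also have "\<dots> \<le> (\<Sum>i\<in>UNIV. A $ i \<bullet> A $ i)"
    by (intro sum_mono Bessel_inequality assms)
  also have "\<dots> = (norm A)\<^sup>2" by (simp add: power2_norm_eq_inner inner_vec_def[of A])
  finally have "(\<Sum>b\<in>B. norm (A *v b))\<^sup>2 \<le> card B * (norm A)\<^sup>2"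
    using sum_squared_le_sum_of_squares[of "\<lambda>b. norm (A *v b)" B]
      mult_right_mono[of "\<Sum>b\<in>B. (norm (A *v b))\<^sup>2" "(norm A)\<^sup>2" "real (card B)"]
    by (simp add: mult.commute)
  then have "sqrt ((\<Sum>b\<in>B. norm (A *v b))\<^sup>2) \<le> sqrt (card B * (norm A)\<^sup>2)"
    by (rule real_sqrt_le_mono)
  then show ?thesis by (simp add: real_sqrt_mult)
qed

lemma bounded_linear_matrix_vector_left: "bounded_linear (\<lambda>A :: real^'n^'m. A *v x)"
  by (rule linear_conv_bounded_linear[THEN iffD1])
    (auto simp: linear_iff matrix_vector_mult_add_rdistrib scaleR_matrix_vector_assoc)

lemma curve_length_lower_bound:
  fixes c :: "real \<Rightarrow> real^'n^'n"
  assumes c: "piecewise_C1_curve c" "c ` {0..1} \<subseteq> orthogonal_group"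
    and B: "finite B" "pairwise orthogonal B" "\<And>b. b \<in> B \<Longrightarrow> norm b = 1"
    and ends: "\<And>b. b \<in> B \<Longrightarrow> c 1 *v b = - (c 0 *v b)"
  shows "sqrt (card B) * pi \<le> curve_length c"
proof -
  obtain N and s :: "nat \<Rightarrow> real" where s: "s 0 = 0" "s N = 1" "\<And>i. i < N \<Longrightarrow> s i < s (Suc i)"
    and C1: "\<And>i. i < N \<Longrightarrow> \<exists>c'. continuous_on {s i..s (Suc i)} c' \<and>
           (\<forall>t\<in>{s i..s (Suc i)}. (c has_vector_derivative c' t) (at t within {s i..s (Suc i)}))"
    using c(1) unfolding piecewise_C1_curve_def by blast
  have s_mono: "s i \<le> s j" if "i \<le> j" "j \<le> N" for i j
    using that
  proof (induction j)
    case (Suc j)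
    then show ?case using s(3)[of j] by (cases "i = Suc j") force+
  qed simp
  have s_in: "{s i..s (Suc i)} \<subseteq> {0..1}" if "i < N" for i
    using s_mono[of 0 i] s_mono[of "Suc i" N] s(1,2) that by auto
  have orth: "orthogonal_matrix (c t)" if "t \<in> {0..1}" for t
    using c(2) that by (auto simp: orthogonal_group_def image_subset_iff)
  let ?v = "\<lambda>t. norm (vector_derivative c (at t))"
  have approx: "card B * (2 * arcsin r) \<le> sqrt (card B) * curve_length c" if r: "0 < r" "r < 1" for r
  proof -
    \<comment> \<open>With \<open>r = 1\<close> each summand would be \<open>pi / 2\<close> minus
      the angle between \<open>c t *v b\<close> and its initial position; it runs from
      \<open>arcsin r\<close> to \<open>- arcsin r\<close>.\<close>
    define g where "g t = (\<Sum>b\<in>B. arcsin (r * ((c t *v b) \<bullet> (c 0 *v b))))" for t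
    \<comment> \<open>The derivative is controlled on one piece at a time, so integrability and the
      estimate are carried together from one break point to the next.\<close>
    have "?v integrable_on {0..s j} \<and> g 0 - g (s j) \<le> sqrt (card B) * integral {0..s j} ?v" if "j \<le> N" for j
      using that
    proof (induction j)
      case 0
      have "?v integrable_on {0..0}"
        using integrable_on_refl[of ?v 0] by (simp only: cbox_interval)
      then show ?case using s(1) by simp
    next
      case (Suc j)
      define a where "a = s j"
      define b where "b = s (Suc j)"
      have ab: "a < b" "0 \<le> a" "{a..b} \<subseteq> {0..1}"
        using s(3)[of j] s_mono[of 0 j] s(1) s_in[of j] Suc.prems by (auto simp: a_def b_def)
      obtain c' where c': "continuous_on {a..b} c'"
        "\<And>t. t \<in> {a..b} \<Longrightarrow> (c has_vector_derivative c' t) (at t within {a..b})"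
        using C1[of j] Suc.prems unfolding a_def b_def by auto
      have "\<exists>d. ((\<lambda>t. arcsin (r * ((c t *v v) \<bullet> (c 0 *v v)))) has_vector_derivative d)
          (at t within {a..b}) \<and> \<bar>d\<bar> \<le> norm (c' t *v v)" if "v \<in> B" "t \<in> {a..b}" for v t
      proof (rule sphere_angle_speed[OF _ _ ab(1) that(2) _ r])
        show "((\<lambda>t. c t *v v) has_vector_derivative c' t *v v) (at t within {a..b})"
          by (rule bounded_linear.has_vector_derivative[OF bounded_linear_matrix_vector_left c'(2)[OF that(2)]])
        show "norm (c s *v v) = 1" if "s \<in> {a..b}" for s
          using orthogonal_matrix_norm[OF orth] ab(3) that B(3) \<open>v \<in> B\<close> by auto
        show "norm (c 0 *v v) = 1"
          using orthogonal_matrix_norm[OF orth, of 0] B(3) \<open>v \<in> B\<close> by auto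
      qed
      then obtain d where d: "\<And>v t. v \<in> B \<Longrightarrow> t \<in> {a..b} \<Longrightarrow>
          ((\<lambda>t. arcsin (r * ((c t *v v) \<bullet> (c 0 *v v)))) has_vector_derivative d v t) (at t within {a..b})"
        "\<And>v t. v \<in> B \<Longrightarrow> t \<in> {a..b} \<Longrightarrow> \<bar>d v t\<bar> \<le> norm (c' t *v v)"
        by metis
      have "(g has_vector_derivative (\<Sum>v\<in>B. d v t)) (at t within {a..b})" if "t \<in> {a..b}" for t
        unfolding g_def by (intro has_vector_derivative_sum d that)
      then have f_int: "((\<lambda>t. \<Sum>v\<in>B. d v t) has_integral (g b - g a)) {a..b}"
        by (intro fundamental_theorem_of_calculus) (use ab in auto)
      have g_int: "((\<lambda>t. - (\<Sum>v\<in>B. d v t)) has_integral (g a - g b)) {a..b}"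
        using has_integral_neg[OF f_int] by simp
      have "(\<lambda>t. norm (c' t)) integrable_on {a..b}"
        by (intro integrable_continuous_real continuous_on_norm c')
      then have n_int: "((\<lambda>t. norm (c' t)) has_integral (integral {a..b} (\<lambda>t. norm (c' t)))) {a..b}"
        by (rule integrable_integral)
      \<comment> \<open>At the ends of a piece the two-sided derivative may fail to exist; these
        points are discarded as a finite set.\<close>
      have "?v t = norm (c' t)" if "t \<in> {a..b} - {a, b}" for t
      proof -
        have "at t within {a..b} = at t"
          using that by (intro at_within_Icc_at) auto
        then show ?thesis using c'(2)[of t] that vector_derivative_at by fastforce
      qed
      then have v_int: "(?v has_integral (integral {a..b} (\<lambda>t. norm (c' t)))) {a..b}"
        by (intro has_integral_spike_finite[OF _ _ n_int, of "{a, b}"]) auto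
      have "- (\<Sum>v\<in>B. d v t) \<le> sqrt (card B) * norm (c' t)" if "t \<in> {a..b}" for t
      proof -
        have "- (\<Sum>v\<in>B. d v t) \<le> (\<Sum>v\<in>B. norm (c' t *v v))"
          unfolding sum_negf[symmetric] using d(2)[OF _ that] by (intro sum_mono) fastforce
        also have "\<dots> \<le> sqrt (card B) * norm (c' t)"
          by (intro sum_norm_matrix_vector_le B)
        finally show ?thesis .
      qed
      then have "g a - g b \<le> sqrt (card B) * integral {a..b} (\<lambda>t. norm (c' t))"
        by (intro has_integral_le[OF g_int has_integral_mult_right[OF n_int]]) auto
      then have step: "g a - g b \<le> sqrt (card B) * integral {a..b} ?v" "?v integrable_on {a..b}"
        using v_int by (auto simp: integral_unique)
      have IH: "?v integrable_on {0..a}" "g 0 - g a \<le> sqrt (card B) * integral {0..a} ?v"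
        using Suc by (auto simp: a_def)
      have "?v integrable_on {0..b}"
        by (rule Henstock_Kurzweil_Integration.integrable_combine[OF ab(2) less_imp_le[OF ab(1)] IH(1) step(2)])
      moreover from this have "integral {0..b} ?v = integral {0..a} ?v + integral {a..b} ?v"
        by (rule Henstock_Kurzweil_Integration.integral_combine[OF ab(2) less_imp_le[OF ab(1)], symmetric])
      ultimately show ?case using IH(2) step(1) by (simp add: b_def[symmetric] distrib_left)
    qed
    from this[of N] have "g 0 - g 1 \<le> sqrt (card B) * curve_length c"
      by (simp add: s(2) curve_length_eq)
    moreover have "(c 0 *v b) \<bullet> (c 0 *v b) = 1" if "b \<in> B" for b
      using B(3)[OF that] orthogonal_matrix_norm[OF orth, of 0 b] by (simp add: dot_square_norm)
    then have "g 0 = card B * arcsin r" "g 1 = card B * arcsin (- r)"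
      unfolding g_def by (simp_all add: ends)
    moreover have "arcsin (- r) = - arcsin r" using r by (intro arcsin_minus) auto
    ultimately show ?thesis by (simp add: algebra_simps)
  qed
  show ?thesis
  proof (cases "card B = 0")
    case True
    then show ?thesis using curve_length_nonneg by simp
  next
    case False
    define m where "m = sqrt (card B)"
    have m: "m > 0" "real (card B) = m * m" using False by (auto simp: m_def)
    have "m * pi - e \<le> curve_length c" if "0 < e" "e < m * pi" for e
    proof -
      \<comment> \<open>Chosen so that \<open>m * (2 * x) = m * pi - e\<close>; \<open>sin x\<close>
        is then an admissible \<open>r\<close>.\<close>
      define x where "x = pi / 2 - e / (2 * m)"
      have x: "0 < x" "x < pi / 2" using that m by (auto simp: x_def field_simps)
      then have "0 < sin x" "sin x < 1" using sin_monotone_2pi[of x "pi/2"] by (auto intro: sin_gt_zero)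
      then have "m * m * (2 * arcsin (sin x)) \<le> m * curve_length c"
        using approx[of "sin x", folded m_def, unfolded m(2)] by simp
      then have "m * (m * (2 * x)) \<le> m * curve_length c" using x by (simp add: arcsin_sin)
      then have "m * (2 * x) \<le> curve_length c" using m(1) by simp
      moreover have "m * (2 * x) = m * pi - e" using m(1) by (simp add: x_def field_simps)
      ultimately show ?thesis by simp
    qed
    then have "m * pi \<le> curve_length c + e" if "0 < e" for e
      using that curve_length_nonneg[of c] by (cases "e < m * pi") fastforce+
    then have "m * pi \<le> curve_length c" by (rule field_le_epsilon)
    then show ?thesis by (simp add: m_def)
  qed
qed

section \<open>Reflections in a subspace\<close>

lemma orthonormal_imp_independent:
  fixes B :: "'a::euclidean_space set"
  assumes "pairwise orthogonal B" "\<And>b. b \<in> B \<Longrightarrow> norm b = 1"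
  shows "independent B"
  using assms by (intro pairwise_orthogonal_independent) fastforce+

lemma orthonormal_expansion:
  fixes B :: "'a::euclidean_space set"
  assumes "finite B" "pairwise orthogonal B" "\<And>b. b \<in> B \<Longrightarrow> norm b = 1" "y \<in> span B"
  shows "(\<Sum>b\<in>B. (b \<bullet> y) *\<^sub>R b) = y"
proof -
  let ?p = "\<Sum>b\<in>B. (b \<bullet> y) *\<^sub>R b"
  have "orthogonal (y - ?p) b" if "b \<in> B" for b
  proof -
    have "?p \<bullet> b = (\<Sum>c\<in>B. if c = b then b \<bullet> y else 0)"
      unfolding inner_sum_left using assms(2,3) that
      by (intro sum.cong refl) (auto simp: pairwise_def orthogonal_def dot_square_norm)
    then show ?thesis
      using assms(1) that by (simp add: orthogonal_def inner_diff_left inner_diff_right inner_commute)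
  qed
  moreover have "y - ?p \<in> span B"
    by (intro span_diff assms(4) span_sum span_scale span_base)
  ultimately have "orthogonal (y - ?p) (y - ?p)"
    using orthogonal_to_span by blast
  then show ?thesis by (simp add: orthogonal_self)
qed

text \<open>\<open>N\<close> is the identity minus twice the projection onto \<open>span B\<close>,
  so its eigenspaces are \<open>span B\<close> and the orthogonal complement.\<close>

lemma sym_orthogonal_reflection:
  fixes N :: "real^'n^'n"
  assumes B: "finite B" "pairwise orthogonal B" "\<And>b. b \<in> B \<Longrightarrow> norm b = 1"
    and N: "orthogonal_matrix N" "transpose N = N" "\<And>y. N *v y = y - 2 *\<^sub>R (\<Sum>b\<in>B. (b \<bullet> y) *\<^sub>R b)"
  shows "N \<in> sym_orthogonal (CARD('n) - card B) (card B)"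
proof -
  have "eigenspace N (-1) = span B"
  proof (intro equalityI subsetI)
    fix y assume "y \<in> eigenspace N (-1)"
    then have "2 *\<^sub>R y = 2 *\<^sub>R (\<Sum>b\<in>B. (b \<bullet> y) *\<^sub>R b)"
      by (simp add: eigenspace_def N(3) algebra_simps scaleR_2)
    then have "y = (\<Sum>b\<in>B. (b \<bullet> y) *\<^sub>R b)" by simp
    also have "\<dots> \<in> span B" by (intro span_sum span_scale span_base)
    finally show "y \<in> span B" .
  next
    fix y assume "y \<in> span B"
    then show "y \<in> eigenspace N (-1)"
      using orthonormal_expansion[OF B] by (simp add: eigenspace_def N(3) scaleR_2)
  qed
  moreover have "dim (span B) = card B"
    using orthonormal_imp_independent[OF B(2,3)] by (simp add: dim_eq_card_independent)
  moreover have "eigenspace N 1 = {y. \<forall>x\<in>span B. orthogonal x y}"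
  proof (intro equalityI subsetI)
    fix y assume "y \<in> eigenspace N 1"
    then have y: "(\<Sum>b\<in>B. (b \<bullet> y) *\<^sub>R b) = 0" by (simp add: eigenspace_def N(3))
    have "b \<bullet> y = 0" if "b \<in> B" for b
      using independentD[OF orthonormal_imp_independent[OF B(2,3)] B(1) _ y] that by blast
    then have "orthogonal y x" if "x \<in> span B" for x
      using that by (intro orthogonal_to_span[of x B]) (auto simp: orthogonal_def inner_commute)
    then show "y \<in> {y. \<forall>x\<in>span B. orthogonal x y}" by (simp add: orthogonal_commute)
  next
    fix y assume "y \<in> {y. \<forall>x\<in>span B. orthogonal x y}"
    then show "y \<in> eigenspace N 1"
      by (simp add: eigenspace_def N(3) span_base orthogonal_def)
  qed
  then have "dim (eigenspace N 1) + dim (span B) = CARD('n)"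
    using dim_subspace_orthogonal_to_vectors[of "span B" "UNIV :: (real^'n) set"]
    by (simp add: dim_UNIV)
  ultimately show ?thesis using N(1,2) by (simp add: sym_orthogonal_def)
qed

section \<open>Diametral pairs\<close>

text \<open>Flattens the indexed pairs into one orthonormal set, the form in which eigenspaces and
  dimensions are counted.\<close>

lemma plane_family_basis:
  fixes u w :: "nat \<Rightarrow> real^'n"
  assumes "plane_family k u w"
  defines "B \<equiv> u ` {..<k} \<union> w ` {..<k}"
  shows "finite B" "pairwise orthogonal B" "\<And>b. b \<in> B \<Longrightarrow> norm b = 1" "card B = 2 * k"
    "\<And>y. (\<Sum>b\<in>B. (b \<bullet> y) *\<^sub>R b) = (\<Sum>i<k. plane_proj (u i) (w i)) *v y"
proof -
  have inner: "u i \<bullet> u j = of_bool (i = j)" "w i \<bullet> w j = of_bool (i = j)" "u i \<bullet> w j = 0" "w j \<bullet> u i = 0"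
    if "i < k" "j < k" for i j
    using assms(1) that by (auto simp: plane_family_def inner_commute)
  show "finite B" by (simp add: B_def)
  show "norm b = 1" if "b \<in> B" for b
    using that inner by (auto simp: B_def norm_eq_1)
  show "pairwise orthogonal B"
    using inner by (auto simp: B_def pairwise_def orthogonal_def)
  have inj: "inj_on u {..<k}" "inj_on w {..<k}"
  proof -
    have "i = j" if "i < k" "j < k" "u i = u j" for i j
      using inner(1)[OF that(1,2)] inner(1)[OF that(1,1)] that(3) by (simp split: if_splits)
    then show "inj_on u {..<k}" by (simp add: inj_on_def)
    have "i = j" if "i < k" "j < k" "w i = w j" for i j
      using inner(2)[OF that(1,2)] inner(2)[OF that(1,1)] that(3) by (simp split: if_splits)
    then show "inj_on w {..<k}" by (simp add: inj_on_def)
  qed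
  have disj: "u ` {..<k} \<inter> w ` {..<k} = {}"
  proof -
    have "u i \<noteq> w j" if "i < k" "j < k" for i j
      using inner(1)[OF that(1,1)] inner(3)[OF that] by auto
    then show ?thesis by auto
  qed
  show "card B = 2 * k"
    unfolding B_def using disj inj by (simp add: card_Un_disjoint card_image)
  show "(\<Sum>b\<in>B. (b \<bullet> y) *\<^sub>R b) = (\<Sum>i<k. plane_proj (u i) (w i)) *v y" for y
    unfolding B_def using disj inj
    by (simp add: sum.union_disjoint sum.reindex plane_proj_def sum.distrib outer_mult_vector
        matrix_vector_mult_add_rdistrib bounded_linear.linear[OF bounded_linear_matrix_vector_left, THEN linear_sum])
qed

lemma rotations_pi:
  "rotations k u w (\<lambda>_. pi) = mat 1 - 2 *\<^sub>R (\<Sum>i<k. plane_proj (u i) (w i))"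
  by (simp add: rotations_def rot_def scaleR_sum_right sum_negf)

lemma rotations_pi_sym_orthogonal:
  fixes u w :: "nat \<Rightarrow> real^'n"
  assumes "plane_family k u w"
  shows "rotations k u w (\<lambda>_. pi) \<in> sym_orthogonal (CARD('n) - 2 * k) (2 * k)"
  unfolding plane_family_basis(4)[OF assms, symmetric]
proof (rule sym_orthogonal_reflection[OF plane_family_basis(1-3)[OF assms]])
  show "orthogonal_matrix (rotations k u w (\<lambda>_. pi))" by (rule orthogonal_matrix_rotations[OF assms])
  show "transpose (rotations k u w (\<lambda>_. pi)) = rotations k u w (\<lambda>_. pi)"
    by (simp add: rotations_pi transpose_linear_simps plane_proj_def transpose_outer)
  show "rotations k u w (\<lambda>_. pi) *v y = y - 2 *\<^sub>R (\<Sum>b\<in>u ` {..<k} \<union> w ` {..<k}. (b \<bullet> y) *\<^sub>R b)" for y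
    unfolding plane_family_basis(5)[OF assms] rotations_pi
    by (simp add: matrix_vector_mult_diff_rdistrib scaleR_matrix_vector_assoc)
qed

lemma plane_family_le:
  fixes u w :: "nat \<Rightarrow> real^'n"
  assumes "plane_family k u w"
  shows "k \<le> CARD('n) div 2"
proof -
  have "2 * k \<le> DIM(real^'n)"
    using independent_card_le[OF orthonormal_imp_independent[OF plane_family_basis(2,3)[OF assms]]]
      plane_family_basis(4)[OF assms] by simp
  then show ?thesis by simp
qed

text \<open>The expected diameter, named separately because \<open>riem_diam_eq\<close> can identify
  it with the supremum only after both bounds are available.\<close>

definition diam_bound :: "'n::finite itself \<Rightarrow> real" where
  "diam_bound _ = sqrt (real (2 * (CARD('n) div 2))) * pi"

lemma connected_component_orthogonal:
  assumes "connected_component orthogonal_group G H"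
  shows "orthogonal_matrix G" "orthogonal_matrix H" "det G = det H"
  using connected_component_in[OF assms] det_connected_component[OF assms]
  by (auto simp: orthogonal_group_def)

text \<open>The curve from the normal form has \<open>k \<le> CARD('n) div 2\<close> planes and
  angles at most \<open>pi\<close>. If the distance equals the bound, there is no slack in either
  estimate: \<open>k\<close> is maximal and every angle is \<open>pi\<close>.\<close>

lemma riem_dist_le:
  fixes G H :: "real^'n^'n"
  assumes "connected_component orthogonal_group G H"
  shows "riem_dist G H \<le> diam_bound TYPE('n)"
    and "riem_dist G H = diam_bound TYPE('n) \<Longrightarrow>
      \<exists>u w. plane_family (CARD('n) div 2) u w \<and> transpose G ** H = rotations (CARD('n) div 2) u w (\<lambda>_. pi)"
proof -
  let ?n = "CARD('n) div 2"
  note GH = connected_component_orthogonal[OF assms]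
  obtain k u w a where kuwa: "plane_family k u w" "\<And>i. i < k \<Longrightarrow> 0 < a i \<and> a i \<le> pi"
    "transpose G ** H = rotations k u w a" "H = G ** rotations k u w a"
    using connected_component_rotations[OF GH] by blast
  have k: "k \<le> ?n" using plane_family_le[OF kuwa(1)] .
  have a2: "(a i)\<^sup>2 \<le> pi\<^sup>2" if "i < k" for i
    using kuwa(2)[OF that] by (intro power_mono) auto
  have sum_le: "(\<Sum>i<k. (a i)\<^sup>2) \<le> k * pi\<^sup>2"
    using sum_mono[of "{..<k}" "\<lambda>i. (a i)\<^sup>2" "\<lambda>_. pi\<^sup>2"] a2 by auto
  have k_le: "k * pi\<^sup>2 \<le> ?n * pi\<^sup>2" using k by (intro mult_right_mono) auto
  have dist: "riem_dist G H \<le> sqrt (2 * (\<Sum>i<k. (a i)\<^sup>2))"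
    using riem_dist_rotations_le[OF GH(1) kuwa(1)] kuwa(4) by metis
  have bound: "diam_bound TYPE('n) = sqrt (2 * (?n * pi\<^sup>2))"
    by (simp add: diam_bound_def real_sqrt_mult)
  have "sqrt (2 * (\<Sum>i<k. (a i)\<^sup>2)) \<le> sqrt (2 * (?n * pi\<^sup>2))"
    using sum_le k_le by (intro real_sqrt_le_mono) linarith
  then show "riem_dist G H \<le> diam_bound TYPE('n)" using dist bound by linarith
  assume "riem_dist G H = diam_bound TYPE('n)"
  then have "sqrt (2 * (?n * pi\<^sup>2)) \<le> sqrt (2 * (\<Sum>i<k. (a i)\<^sup>2))" using dist bound by linarith
  then have "?n * pi\<^sup>2 \<le> (\<Sum>i<k. (a i)\<^sup>2)" by (simp only: real_sqrt_le_iff)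
  then have eq: "(\<Sum>i<k. (a i)\<^sup>2) = k * pi\<^sup>2" "k * pi\<^sup>2 = ?n * pi\<^sup>2"
    using sum_le k_le by linarith+
  have "k = ?n" using eq(2) by simp
  have "(\<Sum>i<k. pi\<^sup>2 - (a i)\<^sup>2) = 0" using eq(1) by (simp add: sum_subtractf)
  then have "(a i)\<^sup>2 = pi\<^sup>2" if "i < k" for i
    using sum_nonneg_eq_0_iff[of "{..<k}" "\<lambda>i. pi\<^sup>2 - (a i)\<^sup>2"] a2 that by auto
  then have "a i = pi" if "i < k" for i
    using kuwa(2)[OF that] that by (metis less_imp_le pi_ge_zero power2_eq_iff_nonneg)
  then have "rotations k u w a = rotations k u w (\<lambda>_. pi)"
    by (simp add: rotations_def)
  then show "\<exists>u w. plane_family ?n u w \<and> transpose G ** H = rotations ?n u w (\<lambda>_. pi)"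
    using kuwa(1,3) \<open>k = ?n\<close> by metis
qed

lemma riem_dist_ge:
  fixes G N :: "real^'n^'n"
  assumes conn: "connected_component orthogonal_group G (G ** N)"
    and N: "N \<in> sym_orthogonal p (2 * (CARD('n) div 2))"
  shows "diam_bound TYPE('n) \<le> riem_dist G (G ** N)"
proof -
  note GH = connected_component_orthogonal[OF conn]
  have "subspace (eigenspace N (-1))"
    by (auto simp: eigenspace_def subspace_def matrix_vector_right_distrib matrix_vector_mult_scaleR)
  then obtain B where B: "B \<subseteq> eigenspace N (-1)" "pairwise orthogonal B" "\<And>b. b \<in> B \<Longrightarrow> norm b = 1"
    "independent B" "card B = dim (eigenspace N (-1))"
    using orthonormal_basis_subspace by metis
  have card: "card B = 2 * (CARD('n) div 2)" using B(5) N by (simp add: sym_orthogonal_def)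
  have "finite B" using B(4) independent_imp_finite by blast
  obtain k u w a where kuwa: "plane_family k u w" "G ** N = G ** rotations k u w a"
    using connected_component_rotations[OF GH] by metis
  show ?thesis
    unfolding riem_dist_def
  proof (rule cInf_greatest)
    \<comment> \<open>The infimum of the empty set is unspecified, so a competing curve has to be
      exhibited.\<close>
    show "{curve_length c |c. piecewise_C1_curve c \<and> c ` {0..1} \<subseteq> orthogonal_group \<and>
        c 0 = G \<and> c 1 = G ** N} \<noteq> {}"
      using rotation_curve[OF GH(1) kuwa(1), of a] unfolding kuwa(2) by blast
    fix l assume "l \<in> {curve_length c |c. piecewise_C1_curve c \<and> c ` {0..1} \<subseteq> orthogonal_group \<and>
        c 0 = G \<and> c 1 = G ** N}"
    then obtain c where c: "l = curve_length c" "piecewise_C1_curve c" "c ` {0..1} \<subseteq> orthogonal_group"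
      "c 0 = G" "c 1 = G ** N" by blast
    have "c 1 *v b = - (c 0 *v b)" if "b \<in> B" for b
    proof -
      have "N *v b = - b" using B(1) that by (auto simp: eigenspace_def)
      then show ?thesis using c(4,5)
        by (simp add: matrix_vector_mul_assoc[symmetric] linear_neg[OF matrix_vector_mul_linear])
    qed
    from curve_length_lower_bound[OF c(2,3) \<open>finite B\<close> B(2,3) this]
    show "diam_bound TYPE('n) \<le> l" by (simp add: card c(1) diam_bound_def)
  qed
qed

lemma sym_orthogonal_0_iff: "(N :: real^'n^'n) \<in> sym_orthogonal 0 CARD('n) \<longleftrightarrow> N = - mat 1"
proof -
  have neg: "(- mat 1) *v x = - (x :: real^'n)" for x
    using matrix_vector_mult_diff_rdistrib[of 0 "mat 1" x] by simp
  show ?thesis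
  proof
    assume "N \<in> sym_orthogonal 0 CARD('n)"
    then have "dim (eigenspace N (-1)) = DIM(real^'n)" by (simp add: sym_orthogonal_def)
    moreover have "subspace (eigenspace N (-1))"
      by (auto simp: eigenspace_def subspace_def matrix_vector_right_distrib matrix_vector_mult_scaleR)
    ultimately have "eigenspace N (-1) = UNIV"
      using dim_eq_full[of "eigenspace N (-1)"] span_eq_iff by blast
    then have "N *v x = (- mat 1) *v x" for x
      using neg by (auto simp: eigenspace_def set_eq_iff)
    then show "N = - mat 1" by (simp add: matrix_eq)
  next
    have "x = 0" if "- x = x" for x :: "real^'n"
    proof -
      have "2 *\<^sub>R x = - x + x" using that by (simp add: scaleR_2)
      then show ?thesis by simp
    qed
    then have "eigenspace (- mat 1 :: real^'n^'n) 1 = {0}" "eigenspace (- mat 1 :: real^'n^'n) (-1) = UNIV"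
      by (auto simp: eigenspace_def neg)
    moreover assume "N = - mat 1"
    ultimately show "N \<in> sym_orthogonal 0 CARD('n)"
      by (simp add: sym_orthogonal_def orthogonal_matrix transpose_linear_simps
          matrix_mult_bilinear_simps dim_UNIV)
  qed
qed

text \<open>Converse of \<open>det_connected_component\<close>: rotation curves show that the
  components are exactly the determinant classes.\<close>

lemma det_eq_imp_connected:
  fixes G H :: "real^'n^'n"
  assumes "orthogonal_matrix G" "orthogonal_matrix H" "det G = det H"
  shows "connected_component orthogonal_group G H"
  using connected_component_rotations[OF assms] rotations_connected[OF assms(1)] by metis

text \<open>For unit \<open>x\<close> this fixes the line through \<open>x\<close> and negates its
  orthogonal complement, the negative of the usual hyperplane reflection.\<close>

definition line_reflection :: "real^'n \<Rightarrow> real^'n^'n" where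
  "line_reflection x = 2 *\<^sub>R outer x x - mat 1"

lemma line_reflection_mult_vector: "line_reflection x *v y = (2 * (x \<bullet> y)) *\<^sub>R x - y"
  by (simp add: line_reflection_def matrix_vector_mult_diff_rdistrib outer_mult_vector
      flip: scaleR_matrix_vector_assoc)

lemma transpose_line_reflection: "transpose (line_reflection x) = line_reflection x"
  by (simp add: line_reflection_def transpose_linear_simps transpose_outer)

lemma line_reflection_involution:
  assumes "norm x = 1"
  shows "line_reflection x ** line_reflection x = mat 1"
proof -
  have "x \<bullet> x = 1" using assms by (simp add: dot_square_norm)
  then have "(line_reflection x ** line_reflection x) *v y = mat 1 *v y" for y
    by (simp add: line_reflection_mult_vector inner_diff_right flip: matrix_vector_mul_assoc)
  then show ?thesis by (simp only: matrix_eq) simp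
qed

lemma orthogonal_matrix_line_reflection:
  assumes "norm x = 1"
  shows "orthogonal_matrix (line_reflection x)"
  using line_reflection_involution[OF assms] by (simp add: orthogonal_matrix transpose_line_reflection)

lemma det_line_reflection:
  fixes x :: "real^'n"
  assumes "norm x = 1" "odd CARD('n)"
  shows "det (line_reflection x) = 1"
proof -
  have "line_reflection x = - (mat 1 - 2 *\<^sub>R outer x x)" by (simp add: line_reflection_def)
  then show ?thesis using det_uminus[of "mat 1 - 2 *\<^sub>R outer x x"] det_reflection[OF assms(1)] assms(2) by simp
qed

lemma eigenspace_line_reflection:
  assumes "norm x = 1"
  shows "eigenspace (line_reflection x) 1 = span {x}"
proof -
  have xx: "x \<bullet> x = 1" using assms by (simp add: dot_square_norm)
  show ?thesis
  proof (intro equalityI subsetI)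
    fix y assume "y \<in> eigenspace (line_reflection x) 1"
    then have "2 *\<^sub>R ((x \<bullet> y) *\<^sub>R x) = 2 *\<^sub>R y"
      by (simp add: eigenspace_def line_reflection_mult_vector scaleR_2 algebra_simps)
    then have "y = (x \<bullet> y) *\<^sub>R x" by (simp only: scaleR_cancel_left) simp
    then show "y \<in> span {x}" by (metis span_base span_scale singletonI)
  next
    fix y assume "y \<in> span {x}"
    then obtain c where "y = c *\<^sub>R x" by (auto simp: span_singleton)
    moreover have "(2 * c) *\<^sub>R x - c *\<^sub>R x = (2 * c - c) *\<^sub>R x"
      by (rule scaleR_left_diff_distrib[symmetric])
    ultimately show "y \<in> eigenspace (line_reflection x) 1"
      by (simp add: eigenspace_def line_reflection_mult_vector xx)
  qed
qed

text \<open>A symmetric orthogonal \<open>A\<close> is an involution, so \<open>y + A *v y\<close>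
  lies in the 1-eigenspace. If that is a line with unit vector \<open>x\<close>, taking the inner
  product with \<open>x\<close> finds the coefficient. The first form suits matrices known up to
  conjugation, the second parametrises the set by unit vectors.\<close>

lemma sym_orthogonal_1_iff:
  fixes A :: "real^'n^'n"
  shows "A \<in> sym_orthogonal 1 (CARD('n) - 1) \<longleftrightarrow>
      transpose A = A \<and> orthogonal_matrix A \<and> dim (eigenspace A 1) = 1" (is "?l \<longleftrightarrow> ?r")
    and "A \<in> sym_orthogonal 1 (CARD('n) - 1) \<longleftrightarrow> (\<exists>x. norm x = 1 \<and> A = line_reflection x)"
      (is "_ \<longleftrightarrow> ?x")
proof -
  have r_x: ?x if r: ?r
  proof -
    have sub: "subspace (eigenspace A 1)"
      by (auto simp: eigenspace_def subspace_def matrix_vector_right_distrib matrix_vector_mult_scaleR)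
    obtain B where B: "B \<subseteq> eigenspace A 1" "\<And>b. b \<in> B \<Longrightarrow> norm b = 1"
      "card B = dim (eigenspace A 1)" "span B = eigenspace A 1"
      using orthonormal_basis_subspace[OF sub] by metis
    then obtain x where x: "norm x = 1" "span {x} = eigenspace A 1"
      using r by (metis card_1_singletonE insertI1)
    have xx: "x \<bullet> x = 1" using x(1) by (simp add: dot_square_norm)
    have Ax: "A *v x = x" using x(2) span_base[of x "{x}"] by (auto simp: eigenspace_def)
    have AA: "A ** A = mat 1" using r by (metis orthogonal_matrix)
    have "A *v y = line_reflection x *v y" for y
    proof -
      have "A *v (y + A *v y) = y + A *v y"
        by (simp add: matrix_vector_right_distrib matrix_vector_mul_assoc AA)
      then have "y + A *v y \<in> span {x}" unfolding x(2) by (simp add: eigenspace_def)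
      then obtain c where c: "y + A *v y = c *\<^sub>R x" by (auto simp: span_singleton)
      have "x \<bullet> (A *v y) = (A *v x) \<bullet> y"
        using r by (simp add: inner_matrix_vector del: transpose_matrix_vector)
      then have "x \<bullet> (y + A *v y) = 2 * (x \<bullet> y)" by (simp add: inner_add_right Ax)
      then have "c = 2 * (x \<bullet> y)" using xx by (simp add: c)
      then show ?thesis using c by (simp add: line_reflection_mult_vector algebra_simps)
    qed
    then show ?thesis using x(1) by (metis matrix_eq)
  qed
  have x_l: ?l if ?x
  proof -
    from that obtain x where x: "norm x = 1" "A = line_reflection x" by blast
    have xx: "x \<bullet> x = 1" using x(1) by (simp add: dot_square_norm)
    then have "x \<noteq> 0" by auto
    have "eigenspace A (-1) = {y. x \<bullet> y = 0}"
      using \<open>x \<noteq> 0\<close> by (auto simp: x(2) eigenspace_def line_reflection_mult_vector)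
    then have "dim (eigenspace A (-1)) = CARD('n) - 1" using dim_hyperplane[OF \<open>x \<noteq> 0\<close>] by simp
    moreover have "dim (eigenspace A 1) = 1"
      unfolding x(2) eigenspace_line_reflection[OF x(1)] using \<open>x \<noteq> 0\<close> by (simp add: dim_singleton)
    ultimately show ?thesis
      using orthogonal_matrix_line_reflection[OF x(1)]
      by (simp add: sym_orthogonal_def x(2) transpose_line_reflection)
  qed
  have l_r: ?r if ?l
    using that by (simp add: sym_orthogonal_def)
  show "?l \<longleftrightarrow> ?r" using r_x x_l l_r by blast
  show "?l \<longleftrightarrow> ?x" using r_x x_l l_r by blast
qed

text \<open>The bound is attained from the identity: at \<open>- mat 1\<close> in even dimension, at
  the half-turn about a line in odd dimension. Both have determinant 1.\<close>

lemma riem_diam_eq: "riem_diam TYPE('n::finite) = diam_bound TYPE('n)"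
  unfolding riem_diam_def
proof (rule cSup_eq_maximum)
  show "d \<le> diam_bound TYPE('n)"
    if "d \<in> {riem_dist G H |G H :: real^'n^'n. connected_component orthogonal_group G H}" for d
    using that riem_dist_le(1) by blast
  have "\<exists>N :: real^'n^'n. orthogonal_matrix N \<and> det N = 1 \<and> (\<exists>p. N \<in> sym_orthogonal p (2 * (CARD('n) div 2)))"
  proof (cases "even CARD('n)")
    case True
    then have "(- mat 1 :: real^'n^'n) \<in> sym_orthogonal 0 (2 * (CARD('n) div 2))"
      using sym_orthogonal_0_iff[of "- mat 1 :: real^'n^'n"] by simp
    moreover have "det (- mat 1 :: real^'n^'n) = 1" using True by (simp add: det_uminus)
    ultimately show ?thesis by (intro exI[of _ "- mat 1"]) (auto simp: sym_orthogonal_def)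
  next
    case False
    \<comment> \<open>Any coordinate direction serves; \<open>undefined\<close> names one.\<close>
    define x :: "real^'n" where "x = axis undefined 1"
    have x: "norm x = 1" by (simp add: x_def)
    have "2 * (CARD('n) div 2) = CARD('n) - 1" using False by presburger
    then have "line_reflection x \<in> sym_orthogonal 1 (2 * (CARD('n) div 2))"
      using sym_orthogonal_1_iff(2)[of "line_reflection x"] x by auto
    then show ?thesis
      using orthogonal_matrix_line_reflection[OF x] det_line_reflection[OF x] False by blast
  qed
  then obtain N :: "real^'n^'n" and p where N: "orthogonal_matrix N" "det N = 1"
    "N \<in> sym_orthogonal p (2 * (CARD('n) div 2))" by blast
  have conn: "connected_component orthogonal_group (mat 1) N"
    using N by (intro det_eq_imp_connected) (simp_all add: orthogonal_matrix_id)
  have "riem_dist (mat 1) N = diam_bound TYPE('n)"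
    using riem_dist_le(1)[OF conn] riem_dist_ge[of "mat 1" N p] conn N(3) by simp
  then show "diam_bound TYPE('n) \<in> {riem_dist G H |G H :: real^'n^'n. connected_component orthogonal_group G H}"
    using conn by (metis (mono_tags, lifting) mem_Collect_eq)
qed

lemma diametral_pair_imp_rotations:
  fixes G H :: "real^'n^'n"
  assumes "diametral_pair G H"
  shows "\<exists>u w. plane_family (CARD('n) div 2) u w \<and> H = G ** rotations (CARD('n) div 2) u w (\<lambda>_. pi)"
proof -
  have conn: "connected_component orthogonal_group G H" and "riem_dist G H = diam_bound TYPE('n)"
    using assms by (auto simp: diametral_pair_def riem_diam_eq)
  then obtain u w where uw: "plane_family (CARD('n) div 2) u w"
    "transpose G ** H = rotations (CARD('n) div 2) u w (\<lambda>_. pi)"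
    using riem_dist_le(2) by blast
  moreover have "H = G ** (transpose G ** H)"
    using orthogonal_matrix_transpose_cancel(2) connected_component_orthogonal(1)[OF conn] by metis
  ultimately show ?thesis by metis
qed

lemma diametral_pair_iff_sym_orthogonal:
  fixes G H :: "real^'n^'n"
  assumes "connected_component orthogonal_group G H"
  shows "diametral_pair G H \<longleftrightarrow> H \<in> left_translation G `
             sym_orthogonal (CARD('n) - 2 * (CARD('n) div 2)) (2 * (CARD('n) div 2))"
proof
  assume "diametral_pair G H"
  then show "H \<in> left_translation G `
             sym_orthogonal (CARD('n) - 2 * (CARD('n) div 2)) (2 * (CARD('n) div 2))"
    using diametral_pair_imp_rotations rotations_pi_sym_orthogonal unfolding left_translation_def by blast
next
  assume "H \<in> left_translation G `
             sym_orthogonal (CARD('n) - 2 * (CARD('n) div 2)) (2 * (CARD('n) div 2))"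
  then obtain N where N: "H = G ** N"
    "N \<in> sym_orthogonal (CARD('n) - 2 * (CARD('n) div 2)) (2 * (CARD('n) div 2))"
    by (auto simp: left_translation_def)
  then have "riem_dist G H = diam_bound TYPE('n)"
    using riem_dist_le(1)[OF assms] riem_dist_ge[OF assms[unfolded N(1)] N(2)] by simp
  then show "diametral_pair G H" using assms by (simp add: diametral_pair_def riem_diam_eq)
qed

text \<open>In odd dimension a half-turn about a line has determinant 1, so the whole translate lies
  in the component of \<open>G\<close> and no connectedness hypothesis on \<open>H\<close>
  remains.\<close>

lemma diametral_pairs_odd:
  fixes G :: "real^'n^'n"
  assumes "orthogonal_matrix G" "odd CARD('n)"
  shows "{H. diametral_pair G H} = left_translation G ` sym_orthogonal 1 (CARD('n) - 1)"
proof -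
  have card: "2 * (CARD('n) div 2) = CARD('n) - 1" "CARD('n) - (CARD('n) - 1) = 1"
    using assms(2) by presburger+
  have "connected_component orthogonal_group G (G ** N)" if N: "N \<in> sym_orthogonal 1 (CARD('n) - 1)" for N
  proof -
    obtain x where x: "norm x = 1" "N = line_reflection x"
      using N unfolding sym_orthogonal_1_iff(2) by blast
    show ?thesis
      using det_line_reflection[OF x(1) assms(2)] orthogonal_matrix_line_reflection[OF x(1)] assms(1)
      by (intro det_eq_imp_connected orthogonal_matrix_mul) (simp_all add: x(2) det_mul)
  qed
  then show ?thesis
    using diametral_pair_iff_sym_orthogonal[of G] unfolding card
    by (auto simp: left_translation_def diametral_pair_def)
qed

section \<open>Geodesics\<close>

lemma inner_matrix_mult_left:
  fixes A B X :: "real^'n^'n"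
  shows "(X ** A) \<bullet> B = A \<bullet> (transpose X ** B)"
  unfolding frob_metric_eq_inner[symmetric] frob_metric_def matrix_transpose_mul matrix_mul_assoc ..

lemma inner_transpose:
  fixes A B :: "real^'n^'m"
  shows "transpose A \<bullet> transpose B = A \<bullet> B"
  unfolding inner_vec_def transpose_def vec_lambda_beta by (rule sum.swap)

lemma inner_symmetric_skew:
  fixes A S :: "real^'n^'n"
  assumes "transpose A = A" "transpose S = - S"
  shows "A \<bullet> S = 0"
  using inner_transpose[of A S] assms by simp

text \<open>Differentiate \<open>transpose (c t) ** c t = mat 1\<close> at 0.\<close>

lemma tangent_space_orthogonal_group:
  fixes X v :: "real^'n^'n"
  assumes "v \<in> tangent_space orthogonal_group X"
  shows "transpose (transpose X ** v) = - (transpose X ** v)"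
proof -
  obtain e c where e: "e > 0" and c: "c ` {-e<..<e} \<subseteq> orthogonal_group" "c 0 = X"
    "(c has_vector_derivative v) (at 0)"
    using assms unfolding tangent_space_def by blast
  have "((\<lambda>t. transpose (c t) ** c t) has_vector_derivative
      (transpose (c 0) ** v + transpose v ** c 0)) (at 0)"
    by (rule bounded_bilinear.has_vector_derivative[OF bounded_bilinear_matrix_mult
          bounded_linear.has_vector_derivative[OF bounded_linear_transpose c(3)] c(3)])
  moreover have "((\<lambda>t. transpose (c t) ** c t) has_vector_derivative 0) (at 0)"
  proof (rule has_vector_derivative_transform_within_open[OF has_vector_derivative_const[of "mat 1"]])
    show "mat 1 = transpose (c t) ** c t" if "t \<in> {-e<..<e}" for t
      using c(1) that by (auto simp: orthogonal_group_def orthogonal_matrix image_subset_iff)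
  qed (use e in auto)
  ultimately have "transpose X ** v + transpose v ** X = 0"
    using vector_derivative_unique_at c(2) by blast
  then show ?thesis by (simp add: matrix_transpose_mul eq_neg_iff_add_eq_0 add.commute)
qed

text \<open>Differentiation stays within this family of curves and changes \<open>A\<close> and
  \<open>B\<close>, so the induction keeps both arbitrary.\<close>

lemma Ck_open_trigonometric:
  fixes A B :: "'a::euclidean_space"
  shows "Ck_open k UNIV (\<lambda>t::real. cos (r * t) *\<^sub>R A + sin (r * t) *\<^sub>R B)"
proof (induction k arbitrary: A B)
  case 0
  show ?case by (auto intro!: continuous_intros)
next
  case (Suc k)
  have der: "((\<lambda>t::real. cos (r * t) *\<^sub>R A + sin (r * t) *\<^sub>R B) has_derivative
      (\<lambda>v. cos (r * t) *\<^sub>R ((v * r) *\<^sub>R B) + sin (r * t) *\<^sub>R ((- v * r) *\<^sub>R A))) (at t)" for t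
    by (auto intro!: derivative_eq_intros simp: fun_eq_iff algebra_simps)
  show ?case
    by (subst Ck_open_Suc_iff[OF open_UNIV der]) (use Suc in blast)
qed

lemma trigonometric_vector_derivative:
  "vector_derivative (\<lambda>t::real. C + cos (r * t) *\<^sub>R A + sin (r * t) *\<^sub>R B) (at t)
     = cos (r * t) *\<^sub>R (r *\<^sub>R B) + sin (r * t) *\<^sub>R (- r *\<^sub>R A)"
  by (rule vector_derivative_at)
    (auto intro!: derivative_eq_intros simp: has_vector_derivative_def fun_eq_iff algebra_simps)

text \<open>All planes turn at the same speed, so the acceleration is \<open>- (r^2)\<close> times
  \<open>c t ** D\<close> with the symmetric projection \<open>D\<close>. Its inner product with a
  tangent \<open>v\<close> is that of \<open>D\<close> with the skew matrix
  \<open>transpose (c t) ** v\<close>, hence 0.\<close>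

lemma geodesic_rotations:
  fixes G :: "real^'n^'n"
  assumes "orthogonal_matrix G" "plane_family k u w"
  shows "geodesic (\<lambda>t. G ** rotations k u w (\<lambda>_. r * t))"
proof -
  define D where "D = (\<Sum>i<k. plane_proj (u i) (w i))"
  define J where "J = (\<Sum>i<k. plane_turn (u i) (w i))"
  define c where "c t = G ** rotations k u w (\<lambda>_. r * t)" for t
  have rot: "rotations k u w (\<lambda>_. s) = mat 1 - D + cos s *\<^sub>R D + sin s *\<^sub>R J" for s
    by (simp add: rotations_def rot_def D_def J_def sum.distrib sum_subtractf scaleR_sum_right algebra_simps)
  have c_eq: "c = (\<lambda>t. G ** (mat 1 - D) + cos (r * t) *\<^sub>R (G ** D) + sin (r * t) *\<^sub>R (G ** J))"
    by (simp add: fun_eq_iff c_def rot matrix_mult_bilinear_simps)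
  have c_orth: "orthogonal_matrix (c t)" for t
    unfolding c_def by (intro orthogonal_matrix_mul assms orthogonal_matrix_rotations)
  have DD: "D ** D = D" and JD: "J ** D = J"
  proof -
    have *: "plane_proj (u i) (w i) ** plane_proj (u j) (w j) = (if j = i then plane_proj (u i) (w i) else 0)"
      "plane_turn (u i) (w i) ** plane_proj (u j) (w j) = (if j = i then plane_turn (u i) (w i) else 0)"
      if "i < k" "j < k" for i j
      using plane_familyD(2)[OF assms(2) that] plane_mult[OF plane_familyD(1)[OF assms(2) that(1)]]
      by (auto simp: plane_proj_def plane_turn_def matrix_mult_bilinear_simps outer_mult_outer)
    have "D ** D = (\<Sum>i<k. \<Sum>j<k. plane_proj (u i) (w i) ** plane_proj (u j) (w j))"
      unfolding D_def by (subst matrix_mult_sum_left, subst matrix_mult_sum_right) simp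
    also have "\<dots> = (\<Sum>i<k. \<Sum>j<k. if j = i then plane_proj (u i) (w i) else 0)"
      by (intro sum.cong refl *) auto
    finally show "D ** D = D" by (simp add: D_def)
    have "J ** D = (\<Sum>i<k. \<Sum>j<k. plane_turn (u i) (w i) ** plane_proj (u j) (w j))"
      unfolding J_def D_def by (subst matrix_mult_sum_left, subst matrix_mult_sum_right) simp
    also have "\<dots> = (\<Sum>i<k. \<Sum>j<k. if j = i then plane_turn (u i) (w i) else 0)"
      by (intro sum.cong refl *) auto
    finally show "J ** D = J" by (simp add: J_def)
  qed
  have "vector_derivative (\<lambda>s. vector_derivative c (at s)) (at t) = - (r\<^sup>2) *\<^sub>R (c t ** D)" for t
  proof -
    have "vector_derivative (\<lambda>s. vector_derivative c (at s)) (at t) =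
        cos (r * t) *\<^sub>R (r *\<^sub>R (- r *\<^sub>R (G ** D))) + sin (r * t) *\<^sub>R (- r *\<^sub>R (r *\<^sub>R (G ** J)))"
      unfolding c_eq trigonometric_vector_derivative
      using trigonometric_vector_derivative[of 0 r "r *\<^sub>R (G ** J)" "- r *\<^sub>R (G ** D)" t] by simp
    moreover have "c t ** D = cos (r * t) *\<^sub>R (G ** D) + sin (r * t) *\<^sub>R (G ** J)"
      by (simp add: c_def rot matrix_mult_bilinear_simps DD JD flip: matrix_mul_assoc)
    ultimately show ?thesis by (simp add: power2_eq_square scaleR_right_distrib mult_ac)
  qed
  moreover have "(c t ** D) \<bullet> v = 0" if "v \<in> tangent_space orthogonal_group (c t)" for v t
    unfolding inner_matrix_mult_left
    by (rule inner_symmetric_skew[OF _ tangent_space_orthogonal_group[OF that]])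
      (simp add: D_def transpose_linear_simps plane_proj_def transpose_outer)
  moreover have "smooth_map UNIV c"
    unfolding c_eq
    by (rule smooth_mapI[OF open_UNIV]) (simp_all only: add.assoc Ck_open_add Ck_open_const Ck_open_trigonometric open_UNIV subset_UNIV)
  moreover have "range c \<subseteq> orthogonal_group" using c_orth by (auto simp: orthogonal_group_def)
  ultimately have "geodesic c" by (simp add: geodesic_def frob_metric_eq_inner)
  then show ?thesis by (simp add: c_def[abs_def])
qed

lemma diametral_imp_weakly_diametral:
  fixes G H :: "real^'n^'n"
  assumes "diametral_pair G H"
  shows "weakly_diametral_pair G H"
proof -
  have conn: "connected_component orthogonal_group G H"
    using assms by (simp add: diametral_pair_def)
  note G = connected_component_orthogonal(1)[OF conn]
  define k where "k = CARD('n) div 2"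
  obtain u w where uw: "plane_family k u w" "H = G ** rotations k u w (\<lambda>_. pi)"
    using diametral_pair_imp_rotations[OF assms] unfolding k_def by blast
  \<comment> \<open>Rotations by \<open>pi\<close> and \<open>- pi\<close> coincide, so this
    geodesic meets \<open>H\<close> at both times 1 and -1.\<close>
  define c where "c t = G ** rotations k u w (\<lambda>_. pi * t)" for t
  have "geodesic c" unfolding c_def[abs_def] by (rule geodesic_rotations[OF G uw(1)])
  moreover have "c 0 = G" "c 1 = H" "c (-1) = H"
    by (simp_all add: c_def uw(2) rotations_def rot_def)
  ultimately show ?thesis using conn by (auto simp: weakly_diametral_pair_def)
qed

section \<open>The Cayley transform\<close>

text \<open>An involution where defined, so a single formula yields a chart and its inverse.\<close>

definition cayley :: "real^'n^'n \<Rightarrow> real^'n^'n" where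
  "cayley A = (mat 1 - A) ** matrix_inv (mat 1 + A)"

text \<open>Lets later identities be proved by clearing the denominator and cancelling it
  again.\<close>

lemma cayley_mult:
  assumes "det (mat 1 + A) \<noteq> 0"
  shows "cayley A ** (mat 1 + A) = mat 1 - A"
  using matrix_inv_mult(2)[OF assms] by (simp add: cayley_def flip: matrix_mul_assoc)

lemma matrix_mult_right_cancel:
  fixes A B C :: "real^'n^'n"
  assumes "A ** C = B ** C" "det C \<noteq> 0"
  shows "A = B"
proof -
  have "A ** C ** matrix_inv C = B ** C ** matrix_inv C" using assms(1) by simp
  then show ?thesis using matrix_inv_mult(1)[OF assms(2)] by (simp flip: matrix_mul_assoc)
qed

lemma matrix_mult_left_cancel:
  fixes A B C :: "real^'n^'n"
  assumes "C ** A = C ** B" "det C \<noteq> 0"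
  shows "A = B"
proof -
  have "matrix_inv C ** (C ** A) = matrix_inv C ** (C ** B)" using assms(1) by simp
  then show ?thesis using matrix_inv_mult(2)[OF assms(2)] by (simp add: matrix_mul_assoc)
qed

text \<open>With \<open>C = cayley A\<close>, multiplying by \<open>mat 1 + A\<close> turns
  \<open>mat 1 + C\<close> into twice the identity and \<open>mat 1 - C\<close> into twice
  \<open>A\<close>. So \<open>mat 1 + C\<close> is invertible and
  \<open>A ** (mat 1 + C) = mat 1 - C\<close>.\<close>

lemma cayley_cayley:
  fixes A :: "real^'n^'n"
  assumes A: "det (mat 1 + A) \<noteq> 0"
  shows "det (mat 1 + cayley A) \<noteq> 0" "cayley (cayley A) = A"
proof -
  let ?C = "cayley A"
  have *: "(mat 1 + ?C) ** (mat 1 + A) = 2 *\<^sub>R mat 1"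
    by (simp only: matrix_mult_bilinear_simps(1) matrix_mul_lid cayley_mult[OF A]) (simp add: scaleR_2)
  then have "(mat 1 + ?C) ** ((1/2) *\<^sub>R (mat 1 + A)) = mat 1"
    by (simp only: matrix_mult_bilinear_simps(10)) simp
  then have "det (mat 1 + ?C) * det ((1/2) *\<^sub>R (mat 1 + A)) = 1"
    by (metis det_I det_mul)
  then show **: "det (mat 1 + ?C) \<noteq> 0" by auto
  have "A ** (mat 1 + ?C) ** (mat 1 + A) = 2 *\<^sub>R A"
    by (simp only: matrix_mul_assoc[symmetric] *) (simp add: matrix_mult_bilinear_simps)
  moreover have "(mat 1 - ?C) ** (mat 1 + A) = 2 *\<^sub>R A"
    by (simp only: matrix_mult_bilinear_simps(3) matrix_mul_lid cayley_mult[OF A]) (simp add: scaleR_2)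
  ultimately have "A ** (mat 1 + ?C) = mat 1 - ?C"
    using matrix_mult_right_cancel[OF _ A] by metis
  then show "cayley ?C = A"
    using cayley_mult[OF **] matrix_mult_right_cancel[OF _ **] by metis
qed

text \<open>For skew \<open>A\<close> the form \<open>x \<bullet> (A *v x)\<close> vanishes, so
  \<open>(mat 1 + A) *v x = 0\<close> forces \<open>x \<bullet> x = 0\<close>.\<close>

lemma det_one_plus_skew:
  fixes A :: "real^'n^'n"
  assumes "transpose A = - A"
  shows "det (mat 1 + A) \<noteq> 0"
proof -
  have "x = 0" if "(mat 1 + A) *v x = 0" for x
  proof -
    have "x \<bullet> (A *v x) = (transpose A *v x) \<bullet> x"
      by (simp only: inner_matrix_vector transpose_transpose)
    also have "\<dots> = - (x \<bullet> (A *v x))"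
      unfolding assms using matrix_vector_mult_diff_rdistrib[of 0 A x] by (simp add: inner_commute)
    finally have "x \<bullet> (A *v x) = 0" by simp
    moreover have "x \<bullet> (x + A *v x) = 0"
      using that by (simp add: matrix_vector_mult_add_rdistrib)
    ultimately show ?thesis by (simp add: inner_add_right)
  qed
  then have "inj ((*v) (mat 1 + A))"
    by (subst linear_injective_0) auto
  then show ?thesis
    using det_nz_iff_inj[OF matrix_vector_mul_linear, of "mat 1 + A"] by simp
qed

text \<open>Clears denominators on both sides, as identities between a Cayley transform and its
  transpose require.\<close>

lemma matrix_congruence_cancel:
  fixes A B C :: "real^'n^'n"
  assumes "transpose C ** A ** C = transpose C ** B ** C" "det C \<noteq> 0"
  shows "A = B"
proof -
  have "transpose C ** A = transpose C ** B" by (rule matrix_mult_right_cancel[OF assms])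
  then show ?thesis by (rule matrix_mult_left_cancel) (simp add: assms(2))
qed

lemma skew_cayley:
  fixes A :: "real^'n^'n"
  assumes A: "orthogonal_matrix A" "det (mat 1 + A) \<noteq> 0"
  shows "transpose (cayley A) = - cayley A"
proof -
  define B C where "B = mat 1 + A" and "C = cayley A"
  have B: "det B \<noteq> 0" and CB: "C ** B = mat 1 - A"
    using A(2) cayley_mult[OF A(2)] by (simp_all add: B_def C_def)
  have "transpose B ** (transpose C + C) ** B = transpose (C ** B) ** B + transpose B ** (C ** B)"
    by (simp only: matrix_transpose_mul matrix_mult_bilinear_simps(1,2) matrix_mul_assoc)
  also have "\<dots> = transpose B ** 0 ** B"
    unfolding CB using A(1)
    by (simp add: B_def transpose_linear_simps matrix_mult_bilinear_simps orthogonal_matrix)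
  finally have "transpose C + C = 0" by (rule matrix_congruence_cancel[OF _ B])
  then show ?thesis by (simp add: C_def eq_neg_iff_add_eq_0)
qed

lemma orthogonal_cayley:
  fixes A :: "real^'n^'n"
  assumes A: "transpose A = - A"
  shows "orthogonal_matrix (cayley A)"
proof -
  define B C where "B = mat 1 + A" and "C = cayley A"
  have B: "det B \<noteq> 0" and CB: "C ** B = mat 1 - A"
    using det_one_plus_skew[OF A] cayley_mult[OF det_one_plus_skew[OF A]] by (simp_all add: B_def C_def)
  have "transpose B ** (transpose C ** C) ** B = transpose (C ** B) ** (C ** B)"
    by (simp only: matrix_transpose_mul matrix_mul_assoc)
  also have "\<dots> = transpose B ** mat 1 ** B"
    unfolding CB by (simp add: B_def transpose_linear_simps matrix_mult_bilinear_simps A)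
  finally have "transpose C ** C = mat 1" by (rule matrix_congruence_cancel[OF _ B])
  then show ?thesis by (simp add: C_def orthogonal_matrix)
qed

lemma open_det_nonzero:
  assumes "continuous_on UNIV (f :: 'a::topological_space \<Rightarrow> real^'n^'n)"
  shows "open {x. det (f x) \<noteq> 0}"
proof -
  have "continuous_on UNIV (\<lambda>x. det (f x))"
    unfolding det_def using assms by (intro continuous_intros)
  then have "open ((\<lambda>x. det (f x)) -` (- {0}))"
    by (rule open_vimage[rotated]) auto
  then show ?thesis by (simp add: vimage_def)
qed

text \<open>The two factors let it cover both the chart (\<open>Q\<close> the identity) and its
  inverse (\<open>P\<close> the identity).\<close>

lemma smooth_map_cayley:
  fixes P Q :: "real^'n^'n"
  assumes "\<And>X. X \<in> S \<Longrightarrow> det (mat 1 + P ** X) \<noteq> 0"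
  shows "smooth_map S (\<lambda>X. Q ** cayley (P ** X))"
proof (rule smooth_mapI)
  let ?W = "{X. det (mat 1 + P ** X) \<noteq> 0}"
  show W: "open ?W"
    by (intro open_det_nonzero continuous_intros bounded_bilinear.continuous_on[OF bounded_bilinear_matrix_mult])
  show "S \<subseteq> ?W" using assms by blast
  show "Ck_open k ?W (\<lambda>X. Q ** cayley (P ** X))" for k
    unfolding cayley_def
    by (intro Ck_open_matrix_mult Ck_open_matrix_inv Ck_open_add Ck_open_diff Ck_open_const Ck_open_id W) auto
qed

lemma subspace_skew: "subspace {A :: real^'n^'n. transpose A = - A}"
  by (auto simp: subspace_def transpose_linear_simps)

section \<open>The Cayley chart around an orthogonal matrix\<close>

context
  fixes P :: "real^'n^'n" and U :: "(real^'n^'n) set" and \<phi> :: "real^'n^'n \<Rightarrow> real^'n^'n"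
  assumes P: "orthogonal_matrix P"
    and U: "U = {X \<in> orthogonal_group. det (mat 1 + transpose P ** X) \<noteq> 0}"
    and \<phi>: "\<phi> = (\<lambda>X. cayley (transpose P ** X))"
begin

lemma cayley_chart_inverse:
  assumes "X \<in> U"
  shows "transpose (\<phi> X) = - \<phi> X" "P ** cayley (\<phi> X) = X"
proof -
  have "orthogonal_matrix (transpose P ** X)"
    using assms P by (intro orthogonal_matrix_mul) (auto simp: U orthogonal_group_def)
  then show "transpose (\<phi> X) = - \<phi> X"
    using assms by (auto simp: U \<phi> intro: skew_cayley)
  show "P ** cayley (\<phi> X) = X"
    using assms by (simp add: U \<phi> cayley_cayley orthogonal_matrix_transpose_cancel[OF P])
qed

lemma cayley_chart_surj:
  assumes "transpose A = - A"
  shows "P ** cayley A \<in> U" "\<phi> (P ** cayley A) = A"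
proof -
  note A = det_one_plus_skew[OF assms]
  show "P ** cayley A \<in> U" "\<phi> (P ** cayley A) = A"
    using cayley_cayley[OF A] orthogonal_cayley[OF assms] P
    by (simp_all add: U \<phi> orthogonal_group_def orthogonal_matrix_transpose_cancel[OF P] orthogonal_matrix_mul)
qed

text \<open>The chart maps onto its whole linear model space, so openness of the image is
  immediate.\<close>

lemma cayley_chart_image: "\<phi> ` U = {A. transpose A = - A}"
  using cayley_chart_inverse(1) cayley_chart_surj by (auto intro!: image_eqI)

lemma cayley_chart: "(U, \<phi>) \<in> charts orthogonal_group"
proof -
  have "open {X. det (mat 1 + transpose P ** X) \<noteq> 0}"
    by (intro open_det_nonzero continuous_intros bounded_bilinear.continuous_on[OF bounded_bilinear_matrix_mult])
  then have "openin (top_of_set orthogonal_group) U"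
    unfolding U by (auto simp: openin_open)
  moreover have inj: "inj_on \<phi> U"
    using cayley_chart_inverse(2) by (metis inj_onI)
  moreover have "smooth_map U \<phi>"
    using smooth_map_cayley[of U "transpose P" "mat 1"] by (simp add: U \<phi>)
  moreover have "smooth_map (\<phi> ` U) (inv_into U \<phi>)"
  proof (rule smooth_map_transform[OF smooth_map_cayley[of "\<phi> ` U" "mat 1" P] subset_refl])
    fix A assume A: "A \<in> \<phi> ` U"
    then show "det (mat 1 + mat 1 ** A) \<noteq> 0"
      using det_one_plus_skew by (auto simp: cayley_chart_image)
    have "transpose A = - A" using A by (simp add: cayley_chart_image)
    from inv_into_f_eq[OF inj cayley_chart_surj[OF this]]
    show "P ** cayley (mat 1 ** A) = inv_into U \<phi> A" by simp
  qed
  moreover have "subspace {A :: real^'n^'n. transpose A = - A} \<and>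
      openin (top_of_set {A. transpose A = - A}) (\<phi> ` U)"
    by (simp add: cayley_chart_image subspace_skew)
  ultimately show ?thesis unfolding charts_def by blast
qed

end

section \<open>The submanifold of reflections in lines\<close>

text \<open>In an orthonormal basis starting with \<open>e\<close>, the conditions leave only the
  blocks that link \<open>e\<close> to its complement. So \<open>A\<close> is determined by
  \<open>A *v e\<close>, an arbitrary vector orthogonal to \<open>e\<close>, and \<open>T\<close>
  inverts this correspondence.\<close>

lemma dim_skew_anticommuting:
  fixes e :: "real^'n"
  assumes "norm e = 1"
  defines "N \<equiv> line_reflection e"
  defines "K \<equiv> {A. transpose A = - A \<and> N ** A ** N = - A}"
  shows "subspace K" "dim K = CARD('n) - 1"
proof -
  have ee: "e \<bullet> e = 1" using assms(1) by (simp add: dot_square_norm)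
  have "e \<noteq> 0" using ee by auto
  show "subspace K"
    by (auto simp: K_def subspace_def transpose_linear_simps matrix_mult_bilinear_simps)
  define T where "T w = outer w e - outer e w" for w :: "real^'n"
  have linear_T: "linear T"
    unfolding T_def using bounded_bilinear_outer
    by (intro bounded_linear.linear bounded_linear_sub bounded_bilinear.bounded_linear_left
        bounded_bilinear.bounded_linear_right)
  have T_e: "T w *v e = w" if "e \<bullet> w = 0" for w
    using that ee by (simp add: T_def matrix_vector_mult_diff_rdistrib outer_mult_vector inner_commute)
  have T_K: "T w \<in> K" if "e \<bullet> w = 0" for w
  proof -
    have "N *v e = e" "N *v w = - w"
      using that ee by (simp_all add: N_def line_reflection_mult_vector scaleR_2)
    then have "N ** T w ** N = - T w"
      by (simp add: T_def matrix_mult_bilinear_simps matrix_mult_outer outer_mult_matrix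
          N_def transpose_line_reflection del: transpose_matrix_vector)
        (simp add: outer_def vec_eq_iff)
    then show ?thesis by (simp add: K_def T_def transpose_linear_simps transpose_outer)
  qed
  have K_T: "A = T (A *v e) \<and> e \<bullet> (A *v e) = 0" if "A \<in> K" for A
  proof
    have sk: "transpose A = - A" and anti: "N ** A ** N = - A" using that by (auto simp: K_def)
    have tA: "transpose A *v v = - (A *v v)" for v
      unfolding sk using matrix_vector_mult_diff_rdistrib[of 0 A v] by simp
    have "e \<bullet> (A *v e) = (transpose A *v e) \<bullet> e"
      by (simp only: inner_matrix_vector transpose_transpose)
    then show eAe: "e \<bullet> (A *v e) = 0" unfolding tA by (simp add: inner_commute)
    let ?E = "outer e e"
    have "?E ** A ** ?E = 0"
      by (simp only: matrix_mul_assoc[symmetric] matrix_mult_outer[of A] outer_mult_outer eAe) simp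
    \<comment> \<open>In the expansion with \<open>N = 2 *\<^sub>R ?E - mat 1\<close> the term with
      \<open>?E\<close> on both sides drops out, because \<open>A\<close> is skew.\<close>
    then have "N ** A ** N = A - 2 *\<^sub>R (?E ** A) - 2 *\<^sub>R (A ** ?E)"
      by (simp add: N_def line_reflection_def matrix_mult_bilinear_simps)
    then have "2 *\<^sub>R A = 2 *\<^sub>R (?E ** A + A ** ?E)"
      unfolding anti by (simp add: scaleR_2 algebra_simps)
    then have "A = ?E ** A + A ** ?E" by (simp only: scaleR_cancel_left) simp
    also have "\<dots> = T (A *v e)"
      by (simp add: T_def outer_mult_matrix matrix_mult_outer tA del: transpose_matrix_vector)
        (simp add: outer_def vec_eq_iff)
    finally show "A = T (A *v e)" .
  qed
  let ?S = "{w. e \<bullet> w = 0}"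
  have "K = T ` ?S" using T_K K_T by blast
  moreover have "inj_on T (span ?S)"
    using T_e by (simp add: span_eq_iff[THEN iffD2, OF subspace_hyperplane]) (metis (mono_tags) inj_onI mem_Collect_eq)
  ultimately have "dim K = dim ?S" using dim_image_eq[OF linear_T] by simp
  then show "dim K = CARD('n) - 1" using dim_hyperplane[OF \<open>e \<noteq> 0\<close>] by simp
qed

text \<open>Conjugation by \<open>N0\<close> sends \<open>N0 ** N\<close> to its inverse
  \<open>N ** N0\<close>, and the Cayley transform turns inversion into a change of sign.\<close>

lemma cayley_involution:
  fixes N0 N :: "real^'n^'n"
  assumes N0: "transpose N0 = N0" "N0 ** N0 = mat 1"
    and N: "transpose N = N" "N ** N = mat 1" "det (mat 1 + N0 ** N) \<noteq> 0"
  shows "N0 ** cayley (N0 ** N) ** N0 = - cayley (N0 ** N)"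
proof -
  let ?Y = "N0 ** N" and ?A = "cayley (N0 ** N)"
  have NN: "N0 ** (N0 ** B) = B" "N ** (N ** B) = B" for B
    by (simp_all add: matrix_mul_assoc N0(2) N(2))
  have tY: "transpose ?Y = N ** N0" by (simp add: matrix_transpose_mul N0 N)
  have A: "?A ** (mat 1 + ?Y) = mat 1 - ?Y" by (rule cayley_mult[OF N(3)])
  have "N0 ** ?A ** N0 ** (mat 1 + N ** N0) = N0 ** (?A ** (mat 1 + ?Y)) ** N0"
    by (simp add: matrix_mult_bilinear_simps(1,2) N0(2) flip: matrix_mul_assoc)
  also have "\<dots> = mat 1 - N ** N0"
    unfolding A by (simp add: matrix_mult_bilinear_simps N0(2) NN flip: matrix_mul_assoc)
  also have "\<dots> = - (?A ** (mat 1 + ?Y)) ** (N ** N0)"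
    unfolding A by (simp add: matrix_mult_bilinear_simps N0(2) NN flip: matrix_mul_assoc)
  also have "\<dots> = - ?A ** (mat 1 + N ** N0)"
    by (simp add: matrix_mult_bilinear_simps N0(2) NN flip: matrix_mul_assoc)
  finally show ?thesis
  proof (rule matrix_mult_right_cancel)
    have "transpose (mat 1 + ?Y) = mat 1 + N ** N0"
      by (simp add: transpose_linear_simps tY)
    then show "det (mat 1 + N ** N0) \<noteq> 0" using N(3) by (metis det_transpose)
  qed
qed

text \<open>Anticommutation gives \<open>N0 ** (mat 1 - A) = (mat 1 + A) ** N0\<close>, so
  \<open>N0 ** cayley A\<close> is the conjugate of \<open>N0\<close> by \<open>mat 1 + A\<close>.
  It is therefore an involution with a one-dimensional fixed space, and being orthogonal it is
  symmetric.\<close>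

lemma cayley_conjugate_reflection:
  fixes A :: "real^'n^'n"
  assumes N0: "N0 \<in> sym_orthogonal 1 (CARD('n) - 1)"
    and A: "transpose A = - A" "N0 ** A ** N0 = - A"
  shows "N0 ** cayley A \<in> sym_orthogonal 1 (CARD('n) - 1)"
proof -
  have N0': "transpose N0 = N0" "orthogonal_matrix N0" "dim (eigenspace N0 1) = 1"
    using N0 unfolding sym_orthogonal_1_iff(1) by auto
  have NN0: "N0 ** N0 = mat 1" using N0'(1,2) by (metis orthogonal_matrix)
  let ?B = "mat 1 + A" and ?N = "N0 ** cayley A"
  note B = det_one_plus_skew[OF A(1)]
  have "N0 ** A = N0 ** A ** N0 ** N0" by (simp add: NN0 flip: matrix_mul_assoc)
  then have comm: "N0 ** A = - (A ** N0)" by (simp add: A(2) matrix_mult_bilinear_simps)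
  have "?N ** ?B = N0 ** (mat 1 - A)" by (simp add: cayley_mult[OF B] flip: matrix_mul_assoc)
  also have "\<dots> = ?B ** N0" by (simp add: matrix_mult_bilinear_simps comm)
  finally have conj: "?N ** ?B = ?B ** N0" .
  have "?N ** ?N ** ?B = ?N ** (?N ** ?B)" by (simp only: matrix_mul_assoc)
  also have "\<dots> = (?N ** ?B) ** N0" unfolding conj by (simp only: matrix_mul_assoc conj)
  also have "\<dots> = mat 1 ** ?B" unfolding conj by (simp add: NN0 flip: matrix_mul_assoc)
  finally have NN: "?N ** ?N = mat 1" by (rule matrix_mult_right_cancel[OF _ B])
  have orth: "orthogonal_matrix ?N" by (intro orthogonal_matrix_mul N0' orthogonal_cayley A)
  have "transpose ?N = transpose ?N ** (?N ** ?N)" by (simp add: NN)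
  then have sym: "transpose ?N = ?N" by (simp only: orthogonal_matrix_transpose_cancel[OF orth])
  have "eigenspace ?N 1 = (*v) ?B ` eigenspace N0 1"
  proof (intro equalityI subsetI)
    fix y assume y: "y \<in> eigenspace ?N 1"
    define z where "z = matrix_inv ?B *v y"
    have y_z: "y = ?B *v z" by (simp add: z_def matrix_vector_mul_assoc matrix_inv_mult[OF B])
    have "?B *v (N0 *v z) = ?B *v z"
      using y y_z by (simp add: eigenspace_def matrix_vector_mul_assoc conj[symmetric])
    then have "matrix_inv ?B *v (?B *v (N0 *v z)) = matrix_inv ?B *v (?B *v z)" by simp
    then have "N0 *v z = z"
      using matrix_inv_mult(2)[OF B] by (simp add: matrix_vector_mul_assoc matrix_mul_assoc)
    then show "y \<in> (*v) ?B ` eigenspace N0 1" using y_z by (auto simp: eigenspace_def)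
  next
    fix y assume "y \<in> (*v) ?B ` eigenspace N0 1"
    then obtain z where z: "y = ?B *v z" "N0 *v z = z" by (auto simp: eigenspace_def)
    have "?N *v y = ?B *v (N0 *v z)" by (simp only: z(1) matrix_vector_mul_assoc conj)
    then show "y \<in> eigenspace ?N 1" by (simp add: eigenspace_def z)
  qed
  moreover have "inj ((*v) ?B)"
    using det_nz_iff_inj[OF matrix_vector_mul_linear, of ?B] B by simp
  ultimately have "dim (eigenspace ?N 1) = 1"
    using dim_image_eq[OF matrix_vector_mul_linear, of ?B "eigenspace N0 1"] N0'(3) inj_on_subset by fastforce
  then show ?thesis using sym orth unfolding sym_orthogonal_1_iff(1) by simp
qed

text \<open>In the Cayley chart centred at \<open>p\<close> the set becomes the subspace
  \<open>K\<close>: \<open>cayley_involution\<close> gives one inclusion,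
  \<open>cayley_conjugate_reflection\<close> the other.\<close>

lemma embedded_submanifold_line_reflections:
  fixes G :: "real^'n^'n"
  assumes G: "orthogonal_matrix G"
  shows "embedded_submanifold (CARD('n) - 1)
    (left_translation G ` sym_orthogonal 1 (CARD('n) - 1)) orthogonal_group"
  unfolding embedded_submanifold_def
proof (intro conjI ballI)
  let ?D = "left_translation G ` sym_orthogonal 1 (CARD('n) - 1)"
  show "?D \<subseteq> orthogonal_group"
    using G by (auto simp: left_translation_def orthogonal_group_def sym_orthogonal_def
        intro: orthogonal_matrix_mul)
  fix p assume "p \<in> ?D"
  then obtain N0 where N0: "p = G ** N0" "N0 \<in> sym_orthogonal 1 (CARD('n) - 1)"
    by (auto simp: left_translation_def)
  then obtain e where e: "norm e = 1" "N0 = line_reflection e"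
    unfolding sym_orthogonal_1_iff(2) by blast
  have N0': "transpose N0 = N0" "N0 ** N0 = mat 1" "orthogonal_matrix N0"
    using e transpose_line_reflection line_reflection_involution orthogonal_matrix_line_reflection by auto
  have p: "orthogonal_matrix p" unfolding N0(1) by (intro orthogonal_matrix_mul G N0')
  define U where "U = {X \<in> orthogonal_group. det (mat 1 + transpose p ** X) \<noteq> 0}"
  define \<phi> where "\<phi> = (\<lambda>X. cayley (transpose p ** X))"
  note chart = cayley_chart[OF p U_def \<phi>_def] and inverse = cayley_chart_inverse[OF p U_def \<phi>_def]
    and surj = cayley_chart_surj[OF p U_def \<phi>_def] and image = cayley_chart_image[OF p U_def \<phi>_def]
  define L where "L = {A :: real^'n^'n. transpose A = - A}"
  define K where "K = {A. transpose A = - A \<and> N0 ** A ** N0 = - A}"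
  have "p \<in> U"
  proof -
    have "mat 1 + transpose p ** p = 2 *\<^sub>R mat 1" using p by (simp add: orthogonal_matrix scaleR_2)
    then have "(mat 1 + transpose p ** p) ** ((1/2) *\<^sub>R mat 1) = mat 1"
      by (simp add: matrix_mult_bilinear_simps)
    then have "det (mat 1 + transpose p ** p) * det ((1/2) *\<^sub>R mat 1 :: real^'n^'n) = 1"
      by (metis det_I det_mul)
    then show ?thesis using p by (auto simp: U_def orthogonal_group_def)
  qed
  moreover have "\<phi> ` (U \<inter> ?D) = \<phi> ` U \<inter> K"
  proof (intro equalityI subsetI)
    fix A assume "A \<in> \<phi> ` (U \<inter> ?D)"
    then obtain N where N: "G ** N \<in> U" "A = \<phi> (G ** N)" "N \<in> sym_orthogonal 1 (CARD('n) - 1)"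
      by (auto simp: left_translation_def)
    \<comment> \<open>In coordinates centred at \<open>p\<close> the translation by \<open>G\<close>
      cancels.\<close>
    have pX: "transpose p ** (G ** N) = N0 ** N"
      by (simp add: N0(1) matrix_transpose_mul N0'(1) orthogonal_matrix_transpose_cancel[OF G] flip: matrix_mul_assoc)
    have N': "transpose N = N" "N ** N = mat 1"
      using N(3) by (auto simp: sym_orthogonal_def) (metis orthogonal_matrix)
    have "N0 ** A ** N0 = - A"
      using cayley_involution[OF N0'(1,2) N'] N(1) by (simp add: N(2) \<phi>_def pX U_def)
    then show "A \<in> \<phi> ` U \<inter> K" using N(1,2) inverse(1) by (auto simp: K_def)
  next
    fix A assume "A \<in> \<phi> ` U \<inter> K"
    then have A: "transpose A = - A" "N0 ** A ** N0 = - A" by (auto simp: K_def)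
    have "p ** cayley A = left_translation G (N0 ** cayley A)"
      by (simp add: N0(1) left_translation_def matrix_mul_assoc)
    then have "p ** cayley A \<in> U \<inter> ?D"
      using surj(1)[OF A(1)] cayley_conjugate_reflection[OF N0(2) A] by auto
    then show "A \<in> \<phi> ` (U \<inter> ?D)" using surj(2)[OF A(1)] by (metis imageI)
  qed
  moreover have "subspace K" "dim K = CARD('n) - 1"
    using dim_skew_anticommuting[OF e(1)] unfolding K_def e(2) by auto
  moreover have "K \<subseteq> L" "subspace L" "openin (top_of_set L) (\<phi> ` U)"
    by (auto simp: K_def L_def image subspace_skew)
  ultimately show "\<exists>(U, \<phi>)\<in>charts orthogonal_group. p \<in> U \<and>
        (\<exists>L K. subspace L \<and> openin (top_of_set L) (\<phi> ` U) \<and>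
           subspace K \<and> K \<subseteq> L \<and> dim K = CARD('n) - 1 \<and> \<phi> ` (U \<inter> ?D) = \<phi> ` U \<inter> K)"
    using chart by (intro bexI[of _ "(U, \<phi>)"]) auto
qed

section \<open>The diffeomorphism with projective space\<close>

lemma span_singleton_projective: "y \<noteq> 0 \<Longrightarrow> span {y} \<in> projective_space"
  by (simp add: projective_space_def dim_singleton)

lemma projective_space_span:
  assumes "l \<in> projective_space" "x \<in> l" "x \<noteq> 0"
  shows "l = span {x}"
proof (rule sym, rule subspace_dim_equal)
  show "subspace l" "span {x} \<subseteq> l"
    using assms span_minimal[of "{x}" l] by (auto simp: projective_space_def)
  show "dim l \<le> dim (span {x})" using assms by (simp add: projective_space_def dim_singleton)
qed (rule subspace_span)

lemma affine_chart_span: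
  fixes y :: "real^'n"
  assumes "y $ i \<noteq> 0"
  shows "span {y} \<in> fst (affine_chart i)" "snd (affine_chart i) (span {y}) = (1 / y $ i) *\<^sub>R y"
proof -
  have "y \<noteq> 0" using assms by auto
  then show "span {y} \<in> fst (affine_chart i)"
    using assms span_base[of y "{y}"] by (auto simp: affine_chart_def span_singleton_projective)
  show "snd (affine_chart i) (span {y}) = (1 / y $ i) *\<^sub>R y"
    unfolding affine_chart_def snd_conv
    by (rule the_equality) (use assms in \<open>auto simp: span_singleton field_simps\<close>)
qed

lemma affine_chart_domain:
  assumes "l \<in> fst (affine_chart i)"
  obtains y where "y $ i = 1" "l = span {y}"
proof -
  obtain x where x: "l \<in> projective_space" "x \<in> l" "x $ i \<noteq> 0"
    using assms by (auto simp: affine_chart_def)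
  define y where "y = (1 / x $ i) *\<^sub>R x"
  have "y $ i = 1" using x(3) by (simp add: y_def)
  moreover have "y \<in> l" using x by (auto simp: y_def projective_space_def intro: subspace_scale)
  moreover have "y \<noteq> 0" using \<open>y $ i = 1\<close> by auto
  ultimately show ?thesis using that projective_space_span[OF x(1)] by blast
qed

lemma affine_chart_inverse:
  fixes y :: "real^'n"
  assumes "y $ i = 1"
  shows "inv_into (fst (affine_chart i)) (snd (affine_chart i)) y = span {y}"
proof (rule inv_into_f_eq)
  show "inj_on (snd (affine_chart i)) (fst (affine_chart i))"
  proof (rule inj_onI)
    fix l m :: "(real^'n) set"
    assume l: "l \<in> fst (affine_chart i)" and m: "m \<in> fst (affine_chart i)"
      and eq: "snd (affine_chart i) l = snd (affine_chart i) m"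
    obtain x where x: "x $ i = 1" "l = span {x}" using affine_chart_domain[OF l] .
    obtain y where y: "y $ i = 1" "m = span {y}" using affine_chart_domain[OF m] .
    show "l = m" using eq affine_chart_span(2)[of x i] affine_chart_span(2)[of y i] x y by simp
  qed
  show "span {y} \<in> fst (affine_chart i)" "snd (affine_chart i) (span {y}) = y"
    using affine_chart_span[of y i] assms by auto
qed

text \<open>\<open>line_reflection\<close> made homogeneous of degree 0: it depends only on the line
  of \<open>y\<close> and is rational, so affine coordinates can be inserted without
  normalising.\<close>

definition reflection_in_span :: "real^'n \<Rightarrow> real^'n^'n" where
  "reflection_in_span y = (2 * inverse (y \<bullet> y)) *\<^sub>R outer y y - mat 1"

lemma reflection_in_span_scaleR:
  assumes "c \<noteq> 0"
  shows "reflection_in_span (c *\<^sub>R x) = reflection_in_span x"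
proof -
  have "outer (c *\<^sub>R x) (c *\<^sub>R x) = (c * c) *\<^sub>R outer x x"
    by (simp add: outer_def vec_eq_iff)
  then show ?thesis using assms by (simp add: reflection_in_span_def field_simps)
qed

lemma reflection_in_span_unit: "norm x = 1 \<Longrightarrow> reflection_in_span x = line_reflection x"
  by (simp add: reflection_in_span_def line_reflection_def dot_square_norm)

section \<open>Half-turns and their fixed lines\<close>

context
  fixes G :: "real^'n^'n" and D :: "(real^'n^'n) set" and F :: "real^'n^'n \<Rightarrow> (real^'n) set"
  assumes G: "orthogonal_matrix G"
    and D: "D = left_translation G ` sym_orthogonal 1 (CARD('n) - 1)"
    and F: "F = (\<lambda>H. eigenspace (transpose G ** H) 1)"
begin

lemma mem_D_iff: "H \<in> D \<longleftrightarrow> (\<exists>x. norm x = 1 \<and> H = G ** line_reflection x)"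
  unfolding D left_translation_def image_iff Bex_def sym_orthogonal_1_iff(2) by metis

lemma F_line_reflection: "norm x = 1 \<Longrightarrow> F (G ** line_reflection x) = span {x}"
  by (simp add: F orthogonal_matrix_transpose_cancel[OF G] eigenspace_line_reflection)

lemma G_reflection_in_span:
  assumes "y \<noteq> 0"
  shows "G ** reflection_in_span y \<in> D" "F (G ** reflection_in_span y) = span {y}"
proof -
  define x where "x = (1 / norm y) *\<^sub>R y"
  have x: "norm x = 1" using assms by (simp add: x_def)
  have "reflection_in_span y = line_reflection x"
    using reflection_in_span_scaleR[of "1 / norm y" y] assms reflection_in_span_unit[OF x] by (simp add: x_def)
  moreover have "span {x} = span {y}"
    using projective_space_span[OF span_singleton_projective[OF assms], of x] x assms
      span_scale[OF span_base[of y "{y}"], of "1 / norm y"] by (auto simp: x_def)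
  ultimately show "G ** reflection_in_span y \<in> D" "F (G ** reflection_in_span y) = span {y}"
    using F_line_reflection[OF x] x mem_D_iff by auto
qed

lemma bij_betw_F: "bij_betw F D projective_space"
proof (rule bij_betw_imageI)
  show "inj_on F D"
  proof (rule inj_onI)
    fix H H' assume "H \<in> D" "H' \<in> D" and eq: "F H = F H'"
    then obtain x y where x: "norm x = 1" "H = G ** line_reflection x"
      and y: "norm y = 1" "H' = G ** line_reflection y" by (auto simp: mem_D_iff)
    have "span {x} = span {y}" using eq x y by (simp add: F_line_reflection)
    then obtain c where c: "x = c *\<^sub>R y" using span_base[of x "{x}"] by (auto simp: span_singleton)
    then have "c \<noteq> 0" using x(1) by auto
    then have "reflection_in_span x = reflection_in_span y"
      unfolding c by (rule reflection_in_span_scaleR)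
    then show "H = H'" using x y by (simp add: reflection_in_span_unit)
  qed
  show "F ` D = projective_space"
  proof (intro equalityI subsetI)
    fix l assume "l \<in> F ` D"
    then obtain x where x: "norm x = 1" "l = span {x}" by (auto simp: mem_D_iff F_line_reflection)
    then have "x \<noteq> 0" by auto
    then show "l \<in> projective_space" using x(2) span_singleton_projective by auto
  next
    fix l :: "(real^'n) set" assume l: "l \<in> projective_space"
    have "l \<noteq> {0}" using l by (auto simp: projective_space_def)
    then obtain x where x: "x \<in> l" "x \<noteq> 0"
      using l subspace_0 by (auto simp: projective_space_def)
    then show "l \<in> F ` D"
      using projective_space_span[OF l x] G_reflection_in_span[of x] by (metis imageI)
  qed
qed

lemma inv_F: "y \<noteq> 0 \<Longrightarrow> inv_into D F (span {y}) = G ** reflection_in_span y"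
  using G_reflection_in_span[of y] bij_betw_F by (intro inv_into_f_eq) (auto simp: bij_betw_def)

text \<open>For \<open>H\<close> in \<open>D\<close> this is the orthogonal projection onto the line
  \<open>F H\<close>. Being affine in \<open>H\<close>, it is defined on all matrices and so carries
  the coordinates of the line beyond \<open>D\<close>.\<close>

definition proj :: "real^'n^'n \<Rightarrow> real^'n^'n" where
  "proj H = (1/2) *\<^sub>R (transpose G ** H + mat 1)"

lemma proj_line_reflection: "proj (G ** line_reflection x) = outer x x"
  by (simp add: proj_def orthogonal_matrix_transpose_cancel[OF G] line_reflection_def)

lemma Ck_open_proj: "open U \<Longrightarrow> Ck_open k U proj"
  unfolding proj_def
  by (intro Ck_open_scaleR Ck_open_add Ck_open_matrix_mult Ck_open_const Ck_open_id)

lemma continuous_on_proj: "continuous_on S proj"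
  using Ck_open_imp_continuous_on[OF Ck_open_proj[OF open_UNIV]] continuous_on_subset by blast

lemma open_proj_nonzero: "open {H. proj H $ i $ i \<noteq> 0}"
proof -
  have "open ((\<lambda>H. proj H $ i $ i) -` (- {0}))"
    by (intro open_vimage continuous_intros continuous_on_proj)
  then show ?thesis by (simp add: vimage_def)
qed

text \<open>Column \<open>i\<close> of the projection onto the line of \<open>x\<close> is
  \<open>x $ i\<close> times \<open>x\<close>; dividing by its \<open>i\<close>-th entry, the square
  of \<open>x $ i\<close>, gives the affine coordinates.\<close>

lemma F_affine_chart:
  assumes "H \<in> D"
  shows "F H \<in> fst (affine_chart i) \<longleftrightarrow> proj H $ i $ i \<noteq> 0"
    and "proj H $ i $ i \<noteq> 0 \<Longrightarrow>
      snd (affine_chart i) (F H) = inverse (proj H $ i $ i) *\<^sub>R (proj H *v axis i 1)"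
proof -
  obtain x where x: "norm x = 1" "H = G ** line_reflection x" using assms by (auto simp: mem_D_iff)
  have pii: "proj H $ i $ i = x $ i * x $ i" by (simp add: x(2) proj_line_reflection outer_def)
  have FH: "F H = span {x}" using x F_line_reflection by simp
  show "F H \<in> fst (affine_chart i) \<longleftrightarrow> proj H $ i $ i \<noteq> 0"
  proof
    assume "F H \<in> fst (affine_chart i)"
    then obtain y where "y \<in> span {x}" "y $ i \<noteq> 0" by (auto simp: FH affine_chart_def)
    then show "proj H $ i $ i \<noteq> 0" by (auto simp: pii span_singleton)
  qed (use affine_chart_span(1)[of x i] FH pii in auto)
  assume "proj H $ i $ i \<noteq> 0"
  then show "snd (affine_chart i) (F H) = inverse (proj H $ i $ i) *\<^sub>R (proj H *v axis i 1)"
    using affine_chart_span(2)[of x i]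
    by (simp add: FH pii) (simp add: x(2) proj_line_reflection outer_mult_vector inner_axis field_simps)
qed

text \<open>The inverse of any chart of \<open>D\<close> lands in \<open>D\<close>, where
  \<open>F\<close> in affine coordinates is the restriction of a rational map on an open set of
  matrices.\<close>

lemma smooth_between_F: "smooth_between (charts D) projective_charts F"
  unfolding smooth_between_def projective_charts_def
proof (intro ballI case_prodI2 impI)
  fix C E U and \<phi> :: "real^'n^'n \<Rightarrow> real^'n^'n" and V and \<psi> :: "(real^'n) set \<Rightarrow> real^'n"
  assume C: "C \<in> charts D" "C = (U, \<phi>)" and E: "E \<in> range affine_chart" "E = (V, \<psi>)"
  obtain i where i: "affine_chart i = (V, \<psi>)" using E by auto
  have U: "openin (top_of_set D) U" "inj_on \<phi> U" "smooth_map (\<phi> ` U) (inv_into U \<phi>)"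
    using C by (auto simp: charts_def)
  have "U \<subseteq> D" using U(1) openin_imp_subset by blast
  have cont: "continuous_on (\<phi> ` U) (inv_into U \<phi>)"
    using smooth_map_imp_continuous_on[OF U(3)] .
  let ?W = "{H. proj H $ i $ i \<noteq> 0}"
  have UV: "U \<inter> F -` V = U \<inter> ?W"
    using F_affine_chart(1)[of _ i] \<open>U \<subseteq> D\<close> by (auto simp: i)
  have image: "\<phi> ` (U \<inter> ?W) = \<phi> ` U \<inter> inv_into U \<phi> -` ?W"
    using U(2) by (auto simp: inv_into_f_f)
  show "openin (top_of_set (\<phi> ` U)) (\<phi> ` (U \<inter> F -` V)) \<and>
     smooth_map (\<phi> ` (U \<inter> F -` V)) (\<psi> \<circ> F \<circ> inv_into U \<phi>)"
  proof
    show "openin (top_of_set (\<phi> ` U)) (\<phi> ` (U \<inter> F -` V))"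
      unfolding UV image by (rule continuous_openin_preimage_gen[OF cont open_proj_nonzero])
    let ?h = "\<lambda>H. inverse (proj H $ i $ i) *\<^sub>R (proj H *v axis i 1)"
    have h: "smooth_map ?W ?h"
    proof (rule smooth_mapI[OF open_proj_nonzero subset_refl])
      have "Ck_open k ?W (\<lambda>H. proj H *v axis i 1)" for k
        by (rule Ck_open_compose[OF open_proj_nonzero Ck_open_proj[OF open_proj_nonzero]
              Ck_open_bounded_linear[OF bounded_linear_matrix_vector_left, of _ UNIV]]) simp
      then show "Ck_open k ?W ?h" for k
        by (intro Ck_open_scaleR Ck_open_inverse Ck_open_nth_matrix Ck_open_proj open_proj_nonzero) auto
    qed
    have inv: "smooth_map (\<phi> ` (U \<inter> ?W)) (inv_into U \<phi>)"
      by (rule smooth_map_transform[OF U(3)]) auto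
    have sub: "inv_into U \<phi> ` \<phi> ` (U \<inter> ?W) \<subseteq> ?W"
      unfolding image by auto
    have "smooth_map (\<phi> ` (U \<inter> ?W)) (\<lambda>y. ?h (inv_into U \<phi> y))"
      by (rule smooth_map_compose[OF inv h sub])
    then show "smooth_map (\<phi> ` (U \<inter> F -` V)) (\<psi> \<circ> F \<circ> inv_into U \<phi>)"
      unfolding UV
    proof (rule smooth_map_transform[OF _ subset_refl])
      fix y assume "y \<in> \<phi> ` (U \<inter> ?W)"
      then obtain H where H: "H \<in> U" "proj H $ i $ i \<noteq> 0" "y = \<phi> H" by auto
      then show "?h (inv_into U \<phi> y) = (\<psi> \<circ> F \<circ> inv_into U \<phi>) y"
        using F_affine_chart(2)[of H i] \<open>U \<subseteq> D\<close> U(2) by (auto simp: i inv_into_f_f)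
    qed
  qed
qed

text \<open>In affine coordinates the inverse is \<open>?g\<close>, rational away from 0; it sends
  the hyperplane \<open>?A\<close> into \<open>D\<close>, where any chart may follow.\<close>

lemma smooth_between_inv_F: "smooth_between projective_charts (charts D) (inv_into D F)"
  unfolding smooth_between_def projective_charts_def
proof (intro ballI case_prodI2 impI)
  fix C E U and \<phi> :: "real^'n^'n \<Rightarrow> real^'n^'n" and V and \<psi> :: "(real^'n) set \<Rightarrow> real^'n"
  assume C: "C \<in> charts D" "C = (U, \<phi>)" and E: "E \<in> range affine_chart" "E = (V, \<psi>)"
  obtain i where i: "affine_chart i = (V, \<psi>)" using E by auto
  have U: "openin (top_of_set D) U" "smooth_map U \<phi>" using C by (auto simp: charts_def)
  let ?A = "{y :: real^'n. y $ i = 1}"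
  let ?g = "\<lambda>y. G ** reflection_in_span y"
  have nz: "y \<noteq> 0" if "y \<in> ?A" for y using that by auto
  have V: "V = (\<lambda>y. span {y}) ` ?A"
  proof (intro equalityI subsetI)
    fix l assume "l \<in> V"
    then have "l \<in> fst (affine_chart i)" by (simp add: i)
    then obtain y where "y $ i = 1" "l = span {y}" by (rule affine_chart_domain)
    then show "l \<in> (\<lambda>y. span {y}) ` ?A" by simp
  next
    fix l assume "l \<in> (\<lambda>y. span {y}) ` ?A"
    then obtain y where "y $ i = 1" "l = span {y}" by auto
    then show "l \<in> V" using affine_chart_span(1)[of y i] by (simp add: i)
  qed
  have \<psi>: "\<psi> (span {y}) = y" if "y \<in> ?A" for y
    using affine_chart_span(2)[of y i] that by (simp add: i)
  have image: "\<psi> ` (V \<inter> inv_into D F -` U) = ?A \<inter> ?g -` U"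
  proof (intro equalityI subsetI)
    fix y assume "y \<in> \<psi> ` (V \<inter> inv_into D F -` U)"
    then obtain z where z: "z \<in> ?A" "inv_into D F (span {z}) \<in> U" "y = \<psi> (span {z})"
      unfolding V by blast
    then show "y \<in> ?A \<inter> ?g -` U" using \<psi>[OF z(1)] inv_F[OF nz[OF z(1)]] by simp
  next
    fix y assume y: "y \<in> ?A \<inter> ?g -` U"
    then have "span {y} \<in> V \<inter> inv_into D F -` U" using inv_F[of y] nz unfolding V by auto
    then show "y \<in> \<psi> ` (V \<inter> inv_into D F -` U)" using \<psi>[of y] y by (metis IntE image_eqI)
  qed
  have image_V: "\<psi> ` V = ?A" unfolding V image_image using \<psi> by simp
  have "smooth_map (- {0}) ?g"
    unfolding reflection_in_span_def
  proof (rule smooth_mapI[OF _ subset_refl])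
    show "open (- {0 :: real^'n})" by auto
    then show "Ck_open k (- {0}) (\<lambda>y. G ** ((2 * inverse (y \<bullet> y)) *\<^sub>R outer y y - mat 1))" for k
      by (intro Ck_open_matrix_mult Ck_open_diff Ck_open_scaleR Ck_open_mult Ck_open_inverse Ck_open_inner
          Ck_open_bilinear[OF bounded_bilinear_outer] Ck_open_const Ck_open_id) auto
  qed
  then have g: "smooth_map ?A ?g" by (rule smooth_map_transform) auto
  show "openin (top_of_set (\<psi> ` V)) (\<psi> ` (V \<inter> inv_into D F -` U)) \<and>
     smooth_map (\<psi> ` (V \<inter> inv_into D F -` U)) (\<phi> \<circ> inv_into D F \<circ> inv_into V \<psi>)"
  proof
    have "?g \<in> ?A \<rightarrow> D" using G_reflection_in_span(1) nz by blast
    then show "openin (top_of_set (\<psi> ` V)) (\<psi> ` (V \<inter> inv_into D F -` U))"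
      unfolding image image_V
      by (rule continuous_openin_preimage[OF smooth_map_imp_continuous_on[OF g] _ U(1)])
    have "smooth_map (?A \<inter> ?g -` U) ?g" by (rule smooth_map_transform[OF g]) auto
    then have "smooth_map (?A \<inter> ?g -` U) (\<lambda>y. \<phi> (?g y))"
      by (rule smooth_map_compose[OF _ U(2)]) auto
    then show "smooth_map (\<psi> ` (V \<inter> inv_into D F -` U)) (\<phi> \<circ> inv_into D F \<circ> inv_into V \<psi>)"
      unfolding image
    proof (rule smooth_map_transform[OF _ subset_refl])
      fix y assume y: "y \<in> ?A \<inter> ?g -` U"
      have "inv_into V \<psi> y = span {y}" using affine_chart_inverse[of y i] y by (simp add: i)
      then show "\<phi> (?g y) = (\<phi> \<circ> inv_into D F \<circ> inv_into V \<psi>) y"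
        using inv_F[of y] nz y by simp
    qed
  qed
qed

lemma diffeomorphic_projective_space:
  "diffeomorphic D (charts D) (projective_space :: (real^'n) set set) projective_charts"
  unfolding diffeomorphic_def using bij_betw_F smooth_between_F smooth_between_inv_F by blast

end

theorem proposition4p18:
  fixes G :: "real^'n^'n"
  assumes "G \<in> orthogonal_group"
  shows
    "(\<forall>H. connected_component orthogonal_group G H \<longrightarrow>
        (diametral_pair G H \<longleftrightarrow>
           H \<in> left_translation G `
             sym_orthogonal (CARD('n) - 2 * (CARD('n) div 2)) (2 * (CARD('n) div 2))) \<and>
        (diametral_pair G H \<longrightarrow> weakly_diametral_pair G H) \<and>
        (even CARD('n) \<longrightarrow> (diametral_pair G H \<longleftrightarrow> H = - G)) \<and>
        (odd CARD('n) \<longrightarrow>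
           (diametral_pair G H \<longleftrightarrow> H \<in> left_translation G ` sym_orthogonal 1 (CARD('n) - 1)))) \<and>
     (odd CARD('n) \<longrightarrow>
        embedded_submanifold (CARD('n) - 1) {H. diametral_pair G H} orthogonal_group \<and>
        diffeomorphic {H. diametral_pair G H} (charts {H. diametral_pair G H})
          (projective_space :: (real^'n) set set) projective_charts)"
proof (intro conjI allI impI)
  have G: "orthogonal_matrix G" using assms by (simp add: orthogonal_group_def)
  fix H assume conn: "connected_component orthogonal_group G H"
  note iff = diametral_pair_iff_sym_orthogonal[OF conn]
  show "diametral_pair G H \<longleftrightarrow> H \<in> left_translation G `
             sym_orthogonal (CARD('n) - 2 * (CARD('n) div 2)) (2 * (CARD('n) div 2))"
    by (rule iff)
  show "weakly_diametral_pair G H" if "diametral_pair G H"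
    using that by (rule diametral_imp_weakly_diametral)
  show "diametral_pair G H \<longleftrightarrow> H = - G" if "even CARD('n)"
  proof -
    \<comment> \<open>For even dimension the multiplicities are 0 and \<open>CARD('n)\<close>, so
      the translated set is a single point.\<close>
    have "{N :: real^'n^'n. N \<in> sym_orthogonal 0 CARD('n)} = {- mat 1}"
      using sym_orthogonal_0_iff by auto
    then show ?thesis
      using iff that by (simp add: left_translation_def matrix_mult_bilinear_simps)
  qed
  show "diametral_pair G H \<longleftrightarrow> H \<in> left_translation G ` sym_orthogonal 1 (CARD('n) - 1)"
    if "odd CARD('n)"
    using diametral_pairs_odd[OF G that] by blast
next
  have G: "orthogonal_matrix G" using assms by (simp add: orthogonal_group_def)
  assume odd: "odd CARD('n)"
  note D = diametral_pairs_odd[OF G odd]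
  show "embedded_submanifold (CARD('n) - 1) {H. diametral_pair G H} orthogonal_group"
    unfolding D by (rule embedded_submanifold_line_reflections[OF G])
  show "diffeomorphic {H. diametral_pair G H} (charts {H. diametral_pair G H})
          (projective_space :: (real^'n) set set) projective_charts"
    by (rule diffeomorphic_projective_space[OF G D refl])
qed

end
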